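(* For every sufficiently large natural number $n$, for every natural number $\alpha$ and for every $x \in \{0,1\}^n$ such that $C(x) \geq \alpha + 7 \log n$, \[ |A_{x, \alpha}| \geq \frac{1}{2n^7}\, 2^{n-\alpha}, \] where $A_{x,\alpha} = \{y \in \{0,1\}^n \mid C(y) - C(y \mid x) \geq \alpha\}$.
   Context: $C(x)$ denotes the plain Kolmogorov complexity of the binary string $x$ with respect to a fixed universal Turing machine $U$, i.e. the length of a shortest program $p$ with $U(p)=x$; $C(x \mid y)$ denotes the conditional plain Kolmogorov complexity of $x$ given $y$ with respect to a fixed universal conditional machine, i.e. the length of a shortest $p$ with $U(p,y)=x$. Logarithms are base $2$. $|S|$ is the cardinality of a finite set $S$. *)

theory Defs
  imports Complex_Main "HOL-Library.Nat_Bijection"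
begin

datatype recf =
    Z
  | Suc_f
  | Proj nat
  | Cn recf "recf list"
  | Pr recf recf
  | Mn recf

inductive eval :: "recf \<Rightarrow> nat list \<Rightarrow> nat \<Rightarrow> bool" where
  eval_Z: "eval Z xs 0"
| eval_Suc: "eval Suc_f (x # xs) (Suc x)"
| eval_Proj: "i < length xs \<Longrightarrow> eval (Proj i) xs (xs ! i)"
| eval_Cn: "list_all2 (\<lambda>g y. eval g xs y) gs ys \<Longrightarrow> eval f ys z \<Longrightarrow> eval (Cn f gs) xs z"
| eval_Pr0: "eval f xs y \<Longrightarrow> eval (Pr f g) (0 # xs) y"
| eval_PrS: "eval (Pr f g) (n # xs) y \<Longrightarrow> eval g (n # y # xs) z \<Longrightarrow> eval (Pr f g) (Suc n # xs) z"
| eval_Mn: "eval f (n # xs) 0 \<Longrightarrow> (\<forall>m<n. \<exists>k. eval f (m # xs) (Suc k)) \<Longrightarrow> eval (Mn f) xs n"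
monos list_all2_mono

definition str_code :: "bool list \<Rightarrow> nat" where
  "str_code xs = list_encode (map (\<lambda>b. if b then 1 else 0) xs)"

definition computable1 :: "(bool list \<Rightarrow> bool list option) \<Rightarrow> bool" where
  "computable1 V \<longleftrightarrow> (\<exists>f. \<forall>p v. eval f [str_code p] v \<longleftrightarrow> (\<exists>x. V p = Some x \<and> v = str_code x))"

definition computable2 :: "(bool list \<Rightarrow> bool list \<Rightarrow> bool list option) \<Rightarrow> bool" where
  "computable2 V \<longleftrightarrow> (\<exists>f. \<forall>p y v. eval f [str_code p, str_code y] v \<longleftrightarrow> (\<exists>x. V p y = Some x \<and> v = str_code x))"

definition universal1 :: "(bool list \<Rightarrow> bool list option) \<Rightarrow> bool" where
  "universal1 U \<longleftrightarrow> computable1 U \<and>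
     (\<forall>V. computable1 V \<longrightarrow> (\<exists>c. \<forall>p x. V p = Some x \<longrightarrow> (\<exists>q. U q = Some x \<and> length q \<le> length p + c)))"

definition universal2 :: "(bool list \<Rightarrow> bool list \<Rightarrow> bool list option) \<Rightarrow> bool" where
  "universal2 U \<longleftrightarrow> computable2 U \<and>
     (\<forall>V. computable2 V \<longrightarrow> (\<exists>c. \<forall>p y x. V p y = Some x \<longrightarrow> (\<exists>q. U q y = Some x \<and> length q \<le> length p + c)))"

definition KC :: "(bool list \<Rightarrow> bool list option) \<Rightarrow> bool list \<Rightarrow> nat" where
  "KC U x = (LEAST k. \<exists>p. length p = k \<and> U p = Some x)"

definition KCc :: "(bool list \<Rightarrow> bool list \<Rightarrow> bool list option) \<Rightarrow> bool list \<Rightarrow> bool list \<Rightarrow> nat" where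
  "KCc U x y = (LEAST k. \<exists>p. length p = k \<and> U p y = Some x)"

definition A_set :: "(bool list \<Rightarrow> bool list option) \<Rightarrow> (bool list \<Rightarrow> bool list \<Rightarrow> bool list option)
    \<Rightarrow> nat \<Rightarrow> bool list \<Rightarrow> nat \<Rightarrow> bool list set" where
  "A_set U V n x \<alpha> = {y. length y = n \<and> int (KC U y) - int (KCc V y x) \<ge> int \<alpha>}"

end

theory Submission
  imports Defs
begin

text \<open>
  Let \<open>p\<close> be a shortest program of \<open>x\<close>, let \<open>z\<close> be its prefix of length
  \<open>l = \<alpha> + 7 log n\<close>, and consider the strings \<open>y = z @ r\<close> of length \<open>n\<close>. Given \<open>x\<close>, such a \<open>y\<close> is
  determined by \<open>r\<close> and the length of \<open>p\<close>, because \<open>p\<close> can be found by search; hence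
  \<open>C(y | x) \<le> n - l + 2 log n + O(1)\<close>. Suppose that at least half of the \<open>r\<close> gave
  \<open>C(z @ r) < n - 4 log n\<close>. By counting there are at most \<open>2 ^ (l - 4 log n + 1)\<close> such prefixes \<open>z\<close>, and
  they can be enumerated, so \<open>z\<close> would be determined by its index and by \<open>n\<close> and \<open>l\<close>, which saves
  \<open>log n - O(1)\<close> bits in the program \<open>p\<close>; this contradicts its minimality. So half of the \<open>y\<close> satisfy
  \<open>C(y) - C(y | x) \<ge> l - 6 log n - O(1) \<ge> \<alpha>\<close>.
\<close>

subsection \<open>Recursive and semidecidable relations\<close>

text \<open>Prefixes of a shortest program supply strings that are nearly incompressible and yet
  cheap to obtain from \<open>x\<close>; the free tail \<open>r\<close> supplies their number. That
  most tails keep \<open>z @ r\<close> complex is the counting argument behind the symmetry of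
  information. The exponent 7 is 4 + 2 + 1. The threshold for C(y) is lowered by 4 log n because a
  program naming \<open>z\<close> by its index must also carry \<open>n\<close> and \<open>l\<close>
  in self-delimiting form, three blocks of log n bits, and must come out shorter by one more log n
  to beat the constant of universality. The length of \<open>p\<close> costs 2 log n in C(y | x).
  The last log n absorbs constants and rounding. The formal obstacle is that computability means
  existence of a \<open>recf\<close> term, while the machines have to run \<open>U\<close>, search
  and enumerate. No term is written out for them: each machine is given by its graph, a relation
  whose definition by quantifiers is semidecidable, and minimization turns every single-valued
  relation of this kind into a program.\<close>

lemma eval_Z_iff: "eval Z xs v \<longleftrightarrow> v = 0"
  by (subst eval.simps) auto

lemma eval_Suc_iff: "eval Suc_f (x # xs) v \<longleftrightarrow> v = Suc x"
  by (subst eval.simps) auto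

lemma eval_Proj_iff: "eval (Proj i) xs v \<longleftrightarrow> i < length xs \<and> v = xs ! i"
  by (subst eval.simps) auto

lemma eval_Cn_iff:
  "eval (Cn f gs) xs z \<longleftrightarrow> (\<exists>ys. list_all2 (\<lambda>g y. eval g xs y) gs ys \<and> eval f ys z)"
  by (subst eval.simps) auto

lemma eval_Pr_0_iff: "eval (Pr f g) (0 # xs) y \<longleftrightarrow> eval f xs y"
  by (subst eval.simps) auto

lemma eval_Pr_Suc_iff:
  "eval (Pr f g) (Suc n # xs) z \<longleftrightarrow> (\<exists>y. eval (Pr f g) (n # xs) y \<and> eval g (n # y # xs) z)"
  by (subst eval.simps) auto

lemma eval_Mn_iff:
  "eval (Mn f) xs n \<longleftrightarrow> eval f (n # xs) 0 \<and> (\<forall>m<n. \<exists>k. eval f (m # xs) (Suc k))"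
  by (subst eval.simps) auto

text \<open>
  A \<open>k\<close>-ary function or relation is represented as a function of an environment \<open>e\<close> whose first \<open>k\<close>
  entries are the arguments. Binders use de Bruijn indices: the bound variable becomes \<open>e 0\<close> and
  the outer environment becomes \<open>\<lambda>n. e (Suc n)\<close>, so that all closure rules are higher-order patterns
  and apply by unification.
\<close>

definition recursive :: "nat \<Rightarrow> ((nat \<Rightarrow> nat) \<Rightarrow> nat) \<Rightarrow> bool" where
  "recursive k F \<longleftrightarrow> (\<exists>f. \<forall>e v. eval f (map e [0..<k]) v \<longleftrightarrow> v = F e)"

definition decidable :: "nat \<Rightarrow> ((nat \<Rightarrow> nat) \<Rightarrow> bool) \<Rightarrow> bool" where
  "decidable k P \<longleftrightarrow> recursive k (\<lambda>e. of_bool (P e))"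

definition semidecidable :: "nat \<Rightarrow> ((nat \<Rightarrow> nat) \<Rightarrow> bool) \<Rightarrow> bool" where
  "semidecidable k P \<longleftrightarrow> (\<exists>Q. decidable (Suc k) (\<lambda>e. Q (e 0) (\<lambda>n. e (Suc n))) \<and> (\<forall>e. P e \<longleftrightarrow> (\<exists>t. Q t e)))"

named_theorems comp_intros

lemma recursive_var [comp_intros]: "i < k \<Longrightarrow> recursive k (\<lambda>e. e i)"
  unfolding recursive_def by (rule exI[of _ "Proj i"]) (simp add: eval_Proj_iff)

lemma recursive_comp:
  assumes "recursive m H" and "\<And>i. i < m \<Longrightarrow> recursive k (\<lambda>e. G e i)"
  shows "recursive k (\<lambda>e. H (G e))"
proof -
  from assms(1) obtain f where f: "\<And>e v. eval f (map e [0..<m]) v \<longleftrightarrow> v = H e"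
    unfolding recursive_def by blast
  have "\<forall>i. \<exists>g. i < m \<longrightarrow> (\<forall>e v. eval g (map e [0..<k]) v \<longleftrightarrow> v = G e i)"
    using assms(2) unfolding recursive_def by blast
  from choice[OF this]
  obtain g where g: "\<forall>i. i < m \<longrightarrow> (\<forall>e v. eval (g i) (map e [0..<k]) v \<longleftrightarrow> v = G e i)" ..
  have *: "list_all2 (\<lambda>h y. eval h (map e [0..<k]) y) (map g [0..<m]) ys \<longleftrightarrow> ys = map (G e) [0..<m]"
    for e ys
  proof
    assume "list_all2 (\<lambda>h y. eval h (map e [0..<k]) y) (map g [0..<m]) ys"
    then show "ys = map (G e) [0..<m]"
      using g by (intro nth_equalityI) (simp_all add: list_all2_conv_all_nth)
  next
    assume "ys = map (G e) [0..<m]"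
    then show "list_all2 (\<lambda>h y. eval h (map e [0..<k]) y) (map g [0..<m]) ys"
      using g by (simp add: list_all2_conv_all_nth)
  qed
  have "eval (Cn f (map g [0..<m])) (map e [0..<k]) v \<longleftrightarrow> v = H (G e)" for e v
    by (simp add: eval_Cn_iff * f)
  then show ?thesis unfolding recursive_def by blast
qed

lemma recursive_comp1:
  assumes "recursive 1 (\<lambda>e. h (e 0))" and "recursive k F"
  shows "recursive k (\<lambda>e. h (F e))"
  using recursive_comp[OF assms(1), of k "\<lambda>e i. F e"] assms(2) by simp

lemma recursive_comp2:
  assumes "recursive 2 (\<lambda>e. h (e 0) (e 1))" and "recursive k F" and "recursive k G"
  shows "recursive k (\<lambda>e. h (F e) (G e))"
proof -
  have "recursive k (\<lambda>e. if i = 0 then F e else G e)" for i :: nat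
    using assms(2,3) by (cases "i = 0") simp_all
  from recursive_comp[OF assms(1), of k "\<lambda>e i. if i = 0 then F e else G e", OF this] show ?thesis by simp
qed

text \<open>Substitution with the head of the environment split off, the shape in which bodies of
  binders occur; it serves to move such a body under further binders.\<close>

lemma recursive_bind:
  assumes "recursive (Suc k) (\<lambda>e. H (e 0) (\<lambda>n. e (Suc n)))" and "recursive j F"
    and "\<And>i. i < k \<Longrightarrow> recursive j (\<lambda>e. G e i)"
  shows "recursive j (\<lambda>e. H (F e) (G e))"
proof -
  have "recursive j (\<lambda>e. case_nat (F e) (G e) i)" if "i < Suc k" for i
    using that assms(2,3) by (cases i) auto
  from recursive_comp[OF assms(1), of j "\<lambda>e. case_nat (F e) (G e)", OF this] show ?thesis by simp
qed

lemma recursive_zero: "recursive k (\<lambda>e. 0)"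
  unfolding recursive_def by (rule exI[of _ Z]) (simp add: eval_Z_iff)

lemma recursive_Suc [comp_intros]:
  assumes "recursive k F" shows "recursive k (\<lambda>e. Suc (F e))"
proof (rule recursive_comp1[OF _ assms])
  show "recursive 1 (\<lambda>e. Suc (e 0))"
    unfolding recursive_def by (rule exI[of _ Suc_f]) (simp add: eval_Suc_iff)
qed

lemma recursive_const [comp_intros]: "recursive k (\<lambda>e. c)"
  by (induction c) (auto intro: recursive_zero recursive_Suc)

lemma recursive_rec [comp_intros]:
  assumes "recursive k N" and "recursive k F"
    and "recursive (Suc (Suc k)) (\<lambda>e. G (e 0) (e (Suc 0)) (\<lambda>n. e (Suc (Suc n))))"
  shows "recursive k (\<lambda>e. rec_nat (F e) (\<lambda>i r. G i r e) (N e))"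
proof -
  from assms(2) obtain f where f: "\<And>e v. eval f (map e [0..<k]) v \<longleftrightarrow> v = F e"
    unfolding recursive_def by blast
  from assms(3) obtain g where
    "\<And>e v. eval g (map e [0..<Suc (Suc k)]) v \<longleftrightarrow> v = G (e 0) (e (Suc 0)) (\<lambda>n. e (Suc (Suc n)))"
    unfolding recursive_def by blast
  \<comment> \<open>\<open>case_nat\<close> puts a value in front of an environment, so a fact about
    all environments becomes one about argument lists headed by \<open>n\<close> and
    \<open>y\<close>.\<close>
  from this[of "case_nat n (case_nat y e)" for n y e]
  have g: "eval g (n # y # map e [0..<k]) v \<longleftrightarrow> v = G n y e" for n y e v
    by (simp add: map_upt_Suc del: upt_Suc)
  have *: "eval (Pr f g) (n # map e [0..<k]) v \<longleftrightarrow> v = rec_nat (F e) (\<lambda>i r. G i r e) n" for n e v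
    by (induction n arbitrary: v) (simp_all add: eval_Pr_0_iff eval_Pr_Suc_iff f g)
  have "recursive (Suc k) (\<lambda>e. rec_nat (F (\<lambda>n. e (Suc n))) (\<lambda>i r. G i r (\<lambda>n. e (Suc n))) (e 0))"
    unfolding recursive_def
    by (rule exI[of _ "Pr f g"]) (simp add: map_upt_Suc * del: upt_Suc)
  from recursive_bind[OF this assms(1), of "\<lambda>e. e"] show ?thesis by (simp add: recursive_var)
qed

section \<open>Arithmetic, connectives and bounded quantifiers\<close>

lemma recursive_add [comp_intros]:
  assumes "recursive k F" "recursive k G" shows "recursive k (\<lambda>e. F e + G e)"
proof -
  have "a + b = rec_nat a (\<lambda>i r. Suc r) b" for a b by (induction b) auto
  then show ?thesis by (simp only:) (intro comp_intros assms; simp)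
qed

lemma recursive_pred: "recursive k F \<Longrightarrow> recursive k (\<lambda>e. F e - Suc 0)"
proof -
  assume "recursive k F"
  have "a - Suc 0 = rec_nat 0 (\<lambda>i r. i) a" for a by (cases a) auto
  then show ?thesis by (simp only:) (intro comp_intros \<open>recursive k F\<close>; simp)
qed

lemma recursive_diff [comp_intros]:
  assumes "recursive k F" "recursive k G" shows "recursive k (\<lambda>e. F e - G e)"
proof -
  have eq: "rec_nat a (\<lambda>i r. r - Suc 0) b = a - b" for a b by (induction b) auto
  have "recursive k (\<lambda>e. rec_nat (F e) (\<lambda>i r. r - Suc 0) (G e))"
    by (intro comp_intros recursive_pred assms; simp)
  then show ?thesis by (simp only: eq)
qed

lemma recursive_mult [comp_intros]:
  assumes "recursive k F" "recursive k G" shows "recursive k (\<lambda>e. F e * G e)"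
proof -
  have "a * b = rec_nat 0 (\<lambda>i r. r + a) b" for a b :: nat by (induction b) auto
  moreover have "recursive k (\<lambda>e. rec_nat 0 (\<lambda>i r. r + F e) (G e))"
  proof (intro comp_intros assms)
    show "recursive (Suc (Suc k)) (\<lambda>e. F (\<lambda>n. e (Suc (Suc n))))"
      by (rule recursive_comp[OF assms(1)]) (simp add: recursive_var)
  qed simp
  ultimately show ?thesis by (simp only:)
qed

lemma recursive_pow2 [comp_intros]:
  assumes "recursive k F" shows "recursive k (\<lambda>e. 2 ^ F e)"
proof -
  have "2 ^ a = rec_nat (1::nat) (\<lambda>i r. r + r) a" for a by (induction a) auto
  then show ?thesis by (simp only:) (intro comp_intros assms; simp)
qed

lemma decidable_not [comp_intros]: "decidable k P \<Longrightarrow> decidable k (\<lambda>e. \<not> P e)"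
proof -
  assume "decidable k P"
  then have "recursive k (\<lambda>e. 1 - of_bool (P e))" unfolding decidable_def by (intro comp_intros)
  moreover have "1 - (of_bool b :: nat) = of_bool (\<not> b)" for b by simp
  ultimately show ?thesis unfolding decidable_def by (simp only:)
qed

lemma decidable_conj [comp_intros]: "decidable k P \<Longrightarrow> decidable k Q \<Longrightarrow> decidable k (\<lambda>e. P e \<and> Q e)"
  unfolding decidable_def of_bool_conj by (intro comp_intros)

lemma decidable_less [comp_intros]:
  assumes "recursive k F" "recursive k G" shows "decidable k (\<lambda>e. F e < G e)"
proof -
  have eq: "1 - (1 - (b - a)) = of_bool (a < b)" for a b :: nat by auto
  have "recursive k (\<lambda>e. 1 - (1 - (G e - F e)))" by (intro comp_intros assms)
  then show ?thesis unfolding decidable_def by (simp only: eq)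
qed

lemma decidable_le [comp_intros]:
  assumes "recursive k F" "recursive k G" shows "decidable k (\<lambda>e. F e \<le> G e)"
  unfolding not_less[symmetric] by (intro comp_intros assms)

lemma decidable_eq [comp_intros]:
  assumes "recursive k F" "recursive k G" shows "decidable k (\<lambda>e. F e = G e)"
proof -
  have "decidable k (\<lambda>e. F e \<le> G e \<and> G e \<le> F e)" by (intro comp_intros assms)
  then show ?thesis by (simp only: eq_iff[symmetric])
qed

lemma recursive_if [comp_intros]:
  assumes "decidable k P" "recursive k F" "recursive k G" shows "recursive k (\<lambda>e. if P e then F e else G e)"
proof -
  have eq: "of_bool b * m + (1 - of_bool b) * n = (if b then m else n)" for b and m n :: nat
    by simp
  have "recursive k (\<lambda>e. of_bool (P e) * F e + (1 - of_bool (P e)) * G e)"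
    using assms unfolding decidable_def by (intro comp_intros)
  then show ?thesis by (simp only: eq)
qed

text \<open>Bounded counting is a primitive recursion over the bound. Bounded quantifiers are
  derived from it, and the ranks used later are such counts.\<close>

lemma recursive_card [comp_intros]:
  assumes "recursive k N" and "decidable (Suc k) (\<lambda>e. P (e 0) (\<lambda>n. e (Suc n)))"
  shows "recursive k (\<lambda>e. card {i. i < N e \<and> P i e})"
proof -
  have "card {i. i < n \<and> P i e} = rec_nat 0 (\<lambda>i r. r + of_bool (P i e)) n" for n e
  proof (induction n)
    case (Suc n)
    have "{i. i < Suc n \<and> P i e} = (if P n e then insert n {i. i < n \<and> P i e} else {i. i < n \<and> P i e})"
      by (auto simp: less_Suc_eq)
    with Suc show ?case by simp
  qed simp
  moreover have "recursive k (\<lambda>e. rec_nat 0 (\<lambda>i r. r + of_bool (P i e)) (N e))"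
  proof (intro comp_intros assms)
    show "recursive (Suc (Suc k)) (\<lambda>e. of_bool (P (e 0) (\<lambda>n. e (Suc (Suc n)))))"
      by (rule recursive_bind[OF assms(2)[unfolded decidable_def], of "Suc (Suc k)" "\<lambda>e. e 0" "\<lambda>e n. e (Suc (Suc n))"])
        (simp_all add: recursive_var)
  qed simp
  ultimately show ?thesis by (simp only:)
qed

lemma decidable_ex [comp_intros]:
  assumes "recursive k N" and "decidable (Suc k) (\<lambda>e. P (e 0) (\<lambda>n. e (Suc n)))"
  shows "decidable k (\<lambda>e. \<exists>i<N e. P i e)"
proof -
  have "(\<exists>i<n. P i e) \<longleftrightarrow> 0 < card {i. i < n \<and> P i e}" for n e
    by (auto simp: card_gt_0_iff)
  then show ?thesis by (simp only:) (intro comp_intros assms)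
qed

lemma decidable_all [comp_intros]:
  assumes "recursive k N" and "decidable (Suc k) (\<lambda>e. P (e 0) (\<lambda>n. e (Suc n)))"
  shows "decidable k (\<lambda>e. \<forall>i<N e. P i e)"
proof -
  have "decidable k (\<lambda>e. \<not> (\<exists>i<N e. \<not> P i e))" by (intro comp_intros assms)
  then show ?thesis by simp
qed

text \<open>Existence for every environment makes the minimization total. Inverses and encoders can
  therefore be given by a decidable specification of their value instead of an algorithm.\<close>

lemma recursive_Least:
  assumes "decidable (Suc k) (\<lambda>e. P (e 0) (\<lambda>n. e (Suc n)))" and ex: "\<And>e. \<exists>v. P v e"
  shows "recursive k (\<lambda>e. LEAST v. P v e)"
proof -
  \<comment> \<open>\<open>Mn\<close> searches for a zero, hence the truth value of the
    negation.\<close>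
  from decidable_not[OF assms(1)] obtain f where
    "\<And>e v. eval f (map e [0..<Suc k]) v \<longleftrightarrow> v = of_bool (\<not> P (e 0) (\<lambda>n. e (Suc n)))"
    unfolding recursive_def decidable_def by blast
  from this[of "case_nat n e" for n e]
  have f: "eval f (n # map e [0..<k]) v \<longleftrightarrow> v = of_bool (\<not> P n e)" for n e v
    by (simp add: map_upt_Suc del: upt_Suc)
  have "eval (Mn f) (map e [0..<k]) v \<longleftrightarrow> v = (LEAST v. P v e)" for e v
  proof -
    have "eval (Mn f) (map e [0..<k]) v \<longleftrightarrow> P v e \<and> (\<forall>m<v. \<not> P m e)"
      by (auto simp: eval_Mn_iff f of_bool_def)
    also have "\<dots> \<longleftrightarrow> v = (LEAST v. P v e)"
      using ex[of e] by (metis LeastI_ex Least_le not_less not_less_Least nat_neq_iff)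
    finally show ?thesis .
  qed
  then show ?thesis unfolding recursive_def by blast
qed

lemma decidable_bind:
  assumes "decidable (Suc k) (\<lambda>e. Q (e 0) (\<lambda>n. e (Suc n)))" and "recursive j F"
    and "\<And>i. i < k \<Longrightarrow> recursive j (\<lambda>e. G e i)"
  shows "decidable j (\<lambda>e. Q (F e) (G e))"
  using recursive_bind[OF assms(1)[unfolded decidable_def] assms(2,3)] unfolding decidable_def .

lemma decidable_comp:
  assumes "decidable m H" and "\<And>i. i < m \<Longrightarrow> recursive k (\<lambda>e. G e i)"
  shows "decidable k (\<lambda>e. H (G e))"
  using recursive_comp[OF assms(1)[unfolded decidable_def] assms(2)] unfolding decidable_def .

lemma recursive_shift:
  assumes "recursive k F" shows "recursive (Suc k) (\<lambda>e. F (\<lambda>n. e (Suc n)))"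
  by (rule recursive_comp[OF assms]) (simp add: recursive_var)

section \<open>Pairs and codes of lists\<close>

lemma recursive_pair [comp_intros]:
  assumes "recursive k F" "recursive k G" shows "recursive k (\<lambda>e. prod_encode (F e, G e))"
proof -
  have eq: "rec_nat 0 (\<lambda>i r. r + Suc i) n = triangle n" for n
    by (induction n) auto
  have "recursive 1 (\<lambda>e. rec_nat 0 (\<lambda>i r. r + Suc i) (e 0))" by (intro comp_intros; simp)
  then have "recursive 1 (\<lambda>e. triangle (e 0))" by (simp only: eq)
  from recursive_comp1[OF this recursive_add[OF assms]] have "recursive k (\<lambda>e. triangle (F e + G e))" .
  then show ?thesis unfolding prod_encode_def by (simp add: recursive_add assms(1))
qed

lemma Least_unique: "(\<And>x. P x \<longleftrightarrow> x = a) \<Longrightarrow> (LEAST x. P x) = (a :: nat)"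
  by (simp add: Least_equality)

text \<open>Both components are at most the code of the pair, so the other one can be quantified
  below \<open>Suc x\<close>, which keeps the specification decidable.\<close>

lemma recursive_fst [comp_intros]:
  assumes "recursive k F" shows "recursive k (\<lambda>e. fst (prod_decode (F e)))"
proof (rule recursive_comp1[OF _ assms])
  have iff: "(\<exists>b<Suc x. prod_encode (a, b) = x) \<longleftrightarrow> a = fst (prod_decode x)" for a x
    by (metis fst_conv le_imp_less_Suc le_prod_encode_2 prod.collapse prod_decode_inverse prod_encode_inverse)
  have "recursive 1 (\<lambda>e. LEAST a. \<exists>b<Suc (e 0). prod_encode (a, b) = e 0)"
    by (rule recursive_Least, (intro comp_intros; simp)) (simp only: iff, blast)
  then show "recursive 1 (\<lambda>e. fst (prod_decode (e 0)))" by (simp only: iff Least_unique)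
qed

lemma recursive_snd [comp_intros]:
  assumes "recursive k F" shows "recursive k (\<lambda>e. snd (prod_decode (F e)))"
proof (rule recursive_comp1[OF _ assms])
  have iff: "(\<exists>a<Suc x. prod_encode (a, b) = x) \<longleftrightarrow> b = snd (prod_decode x)" for b x
    by (metis snd_conv le_imp_less_Suc le_prod_encode_1 prod.collapse prod_decode_inverse prod_encode_inverse)
  have "recursive 1 (\<lambda>e. LEAST b. \<exists>a<Suc (e 0). prod_encode (a, b) = e 0)"
    by (rule recursive_Least, (intro comp_intros; simp)) (simp only: iff, blast)
  then show "recursive 1 (\<lambda>e. snd (prod_decode (e 0)))" by (simp only: iff Least_unique)
qed

text \<open>A cons is coded as \<open>Suc\<close> of a pair and the empty list as 0. Since
  \<open>prod_decode 0\<close> is the pair of zeros, 0 is its own tail, and dropping past the end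
  stays at the empty list.\<close>

definition code_drop :: "nat \<Rightarrow> nat \<Rightarrow> nat" where
  "code_drop c i = rec_nat c (\<lambda>_ r. snd (prod_decode (r - 1))) i"

definition code_nth :: "nat \<Rightarrow> nat \<Rightarrow> nat" where
  "code_nth c i = fst (prod_decode (code_drop c i - 1))"

lemma recursive_code_drop [comp_intros]: "recursive k F \<Longrightarrow> recursive k G \<Longrightarrow> recursive k (\<lambda>e. code_drop (F e) (G e))"
  unfolding code_drop_def by (intro comp_intros; simp)

lemma recursive_code_nth [comp_intros]: "recursive k F \<Longrightarrow> recursive k G \<Longrightarrow> recursive k (\<lambda>e. code_nth (F e) (G e))"
  unfolding code_nth_def by (intro comp_intros)

lemma list_decode_tl: "list_decode (snd (prod_decode (c - 1))) = tl (list_decode c)"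
proof (cases c)
  case 0
  then have "snd (prod_decode (c - 1)) = 0"
    by (metis diff_0_eq_0 le_prod_encode_2 le_zero_eq prod.collapse prod_decode_inverse)
  with 0 show ?thesis by simp
qed (simp split: prod.split)

lemma list_decode_code_drop: "list_decode (code_drop c i) = drop i (list_decode c)"
proof (induction i)
  case (Suc i)
  have "code_drop c (Suc i) = snd (prod_decode (code_drop c i - 1))" by (simp add: code_drop_def)
  then have "list_decode (code_drop c (Suc i)) = tl (list_decode (code_drop c i))"
    by (simp only: list_decode_tl)
  with Suc show ?case by (simp add: drop_Suc tl_drop)
qed (simp add: code_drop_def)

lemma list_decode_eq_Nil: "list_decode c = [] \<longleftrightarrow> c = 0"
  by (cases c) (simp_all split: prod.split)

lemma code_nth_eq: "i < length (list_decode c) \<Longrightarrow> code_nth c i = list_decode c ! i"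
proof -
  assume i: "i < length (list_decode c)"
  then have "code_drop c i \<noteq> 0"
    using list_decode_code_drop[of c i] list_decode_eq_Nil[of "code_drop c i"] by auto
  then obtain m where m: "code_drop c i = Suc m" by (cases "code_drop c i") auto
  have "list_decode c ! i = hd (list_decode (code_drop c i))"
    using i by (simp add: list_decode_code_drop hd_drop_conv_nth)
  also have "\<dots> = code_nth c i" by (simp add: code_nth_def m split: prod.split)
  finally show ?thesis by simp
qed

lemma recursive_length_decode [comp_intros]:
  assumes "recursive k F" shows "recursive k (\<lambda>e. length (list_decode (F e)))"
proof (rule recursive_comp1[OF _ assms])
  have 0: "code_drop c i = 0 \<longleftrightarrow> length (list_decode c) \<le> i" for c i
    by (metis drop_eq_Nil list_decode_code_drop list_decode_eq_Nil)
  then have "(LEAST i. code_drop c i = 0) = length (list_decode c)" for c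
    by (intro Least_equality) simp_all
  moreover have "recursive 1 (\<lambda>e. LEAST i. code_drop (e 0) i = 0)"
    by (rule recursive_Least, (intro comp_intros; simp)) (auto simp: 0)
  ultimately show "recursive 1 (\<lambda>e. length (list_decode (e 0)))" by simp
qed

lemma eq_list_encode_iff:
  "c = list_encode xs \<longleftrightarrow> length (list_decode c) = length xs \<and> (\<forall>i<length xs. code_nth c i = xs ! i)"
proof
  assume *: "length (list_decode c) = length xs \<and> (\<forall>i<length xs. code_nth c i = xs ! i)"
  then have "list_decode c = xs" by (intro nth_equalityI) (simp_all add: code_nth_eq[symmetric])
  then show "c = list_encode xs" by auto
qed (simp add: code_nth_eq)

text \<open>The code is found by search, since a length and a bounded quantifier over the entries
  specify it. Append and the normalization of string codes are instances.\<close>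

lemma recursive_list_encode:
  assumes "recursive k L" and "recursive (Suc k) (\<lambda>e. X (e 0) (\<lambda>n. e (Suc n)))"
    and len: "\<And>e. length (xs e) = L e" and nth: "\<And>e i. i < L e \<Longrightarrow> xs e ! i = X i e"
  shows "recursive k (\<lambda>e. list_encode (xs e))"
proof -
  have iff: "length (list_decode c) = L e \<and> (\<forall>i<L e. code_nth c i = X i e) \<longleftrightarrow> c = list_encode (xs e)" for c e
    using eq_list_encode_iff[of c "xs e"] len nth by auto
  have "recursive k (\<lambda>e. LEAST c. length (list_decode c) = L e \<and> (\<forall>i<L e. code_nth c i = X i e))"
  proof (rule recursive_Least)
    have "recursive (Suc (Suc k)) (\<lambda>e. X (e 0) (\<lambda>n. e (Suc (Suc n))))"
      by (rule recursive_bind[OF assms(2)]) (simp_all add: recursive_var)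
    then show "decidable (Suc k) (\<lambda>e. length (list_decode (e 0)) = L (\<lambda>n. e (Suc n)) \<and>
        (\<forall>i<L (\<lambda>n. e (Suc n)). code_nth (e 0) i = X i (\<lambda>n. e (Suc n))))"
      by (intro comp_intros recursive_shift assms(1); simp)
  qed (simp only: iff, blast)
  then show ?thesis by (simp only: iff Least_unique)
qed

section \<open>Binary strings as numbers\<close>

text \<open>Decoding is total, so quantifiers over strings can be replaced by quantifiers over
  numbers. It is not injective; where strings are counted, codes are restricted by
  \<open>str_code (str_decode c) = c\<close>.\<close>

definition str_decode :: "nat \<Rightarrow> bool list" where
  "str_decode c = map (\<lambda>x. x \<noteq> 0) (list_decode c)"

definition recursive_str :: "nat \<Rightarrow> ((nat \<Rightarrow> nat) \<Rightarrow> bool list) \<Rightarrow> bool" where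
  "recursive_str k F \<longleftrightarrow> recursive k (\<lambda>e. str_code (F e))"

lemma str_decode_str_code [simp]: "str_decode (str_code s) = s"
  by (simp add: str_decode_def str_code_def comp_def map_idI)

lemma str_code_inject [simp]: "str_code s = str_code t \<longleftrightarrow> s = t"
  by (metis str_decode_str_code)

lemma ex_str_decode: "(\<exists>c. P (str_decode c)) \<longleftrightarrow> (\<exists>s. P s)"
  by (metis str_decode_str_code)

lemma recursive_str_str_decode [comp_intros]:
  assumes "recursive k F" shows "recursive_str k (\<lambda>e. str_decode (F e))"
  unfolding recursive_str_def
proof (rule recursive_comp1[OF _ assms])
  have "recursive 1 (\<lambda>e. list_encode (map (\<lambda>x. if x = 0 then 0 else 1) (list_decode (e 0))))"
    by (rule recursive_list_encode[where L = "\<lambda>e. length (list_decode (e 0))"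
          and X = "\<lambda>i e. if code_nth (e 0) i = 0 then 0 else 1"])
      ((intro comp_intros; simp), (intro comp_intros; simp), simp_all add: code_nth_eq)
  moreover have "str_code (str_decode c) = list_encode (map (\<lambda>x. if x = 0 then 0 else 1) (list_decode c))" for c
    unfolding str_code_def str_decode_def map_map
    by (rule arg_cong[of _ _ list_encode], rule map_cong) auto
  ultimately show "recursive 1 (\<lambda>e. str_code (str_decode (e 0)))" by simp
qed

lemma recursive_str_code [comp_intros]: "recursive_str k F \<Longrightarrow> recursive k (\<lambda>e. str_code (F e))"
  by (simp add: recursive_str_def)

lemma recursive_length [comp_intros]:
  assumes "recursive_str k F" shows "recursive k (\<lambda>e. length (F e))"
proof -
  have "length s = length (list_decode (str_code s))" for s by (simp add: str_code_def)
  then show ?thesis by (simp only:) (intro comp_intros assms)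
qed

lemma decidable_str_eq [comp_intros]:
  assumes "recursive_str k F" "recursive_str k G" shows "decidable k (\<lambda>e. F e = G e)"
proof -
  have "decidable k (\<lambda>e. str_code (F e) = str_code (G e))" by (intro comp_intros assms)
  then show ?thesis by simp
qed

lemma recursive_str_const [comp_intros]: "recursive_str k (\<lambda>e. s)"
  unfolding recursive_str_def by (intro comp_intros)

lemma recursive_str_append [comp_intros]:
  assumes "recursive_str k F" "recursive_str k G" shows "recursive_str k (\<lambda>e. F e @ G e)"
proof -
  have "recursive 2 (\<lambda>e. list_encode (list_decode (e 0) @ list_decode (e 1)))"
    by (rule recursive_list_encode[where L = "\<lambda>e. length (list_decode (e 0)) + length (list_decode (e 1))"
          and X = "\<lambda>i e. if i < length (list_decode (e 0)) then code_nth (e 0) i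
            else code_nth (e 1) (i - length (list_decode (e 0)))"])
      ((intro comp_intros; simp), (intro comp_intros; simp), simp_all add: code_nth_eq nth_append)
  from recursive_comp2[OF this, of k "\<lambda>e. str_code (F e)" "\<lambda>e. str_code (G e)"] assms
  show ?thesis by (simp add: recursive_str_def str_code_def)
qed

lemma recursive_str_replicate [comp_intros]:
  assumes "recursive k F" shows "recursive_str k (\<lambda>e. replicate (F e) True)"
proof -
  have "rec_nat 0 (\<lambda>i r. Suc (prod_encode (1, r))) n = str_code (replicate n True)" for n
    by (induction n) (simp_all add: str_code_def)
  moreover have "recursive k (\<lambda>e. rec_nat 0 (\<lambda>i r. Suc (prod_encode (1, r))) (F e))"
    by (intro comp_intros assms; simp)
  ultimately show ?thesis by (simp add: recursive_str_def)
qed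

lemma decidable_const [comp_intros]: "decidable k (\<lambda>e. b)"
  unfolding decidable_def by (intro comp_intros)

section \<open>Closure properties of semidecidable relations\<close>

lemma semidecidable_decidable:
  assumes "decidable k P" shows "semidecidable k P"
proof -
  have "decidable (Suc k) (\<lambda>e. P (\<lambda>n. e (Suc n)))"
    by (rule decidable_comp[OF assms]) (simp add: recursive_var)
  then show ?thesis unfolding semidecidable_def by (intro exI[of _ "\<lambda>_. P"]) simp
qed

lemma semidecidableE:
  assumes "semidecidable (Suc k) (\<lambda>e. P (e 0) (\<lambda>n. e (Suc n)))"
  obtains Q where "decidable (Suc (Suc k)) (\<lambda>e. Q (e 0) (\<lambda>n. e (Suc n)))"
    and "\<And>x e. P x e \<longleftrightarrow> (\<exists>t. Q t (case_nat x e))"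
proof -
  from assms obtain Q where Q: "decidable (Suc (Suc k)) (\<lambda>e. Q (e 0) (\<lambda>n. e (Suc n)))"
    and P: "\<And>e. P (e 0) (\<lambda>n. e (Suc n)) \<longleftrightarrow> (\<exists>t. Q t e)"
    unfolding semidecidable_def by blast
  from P[of "case_nat x e" for x e] have "P x e \<longleftrightarrow> (\<exists>t. Q t (case_nat x e))" for x e
    by simp
  with Q show thesis by (rule that)
qed

lemma semidecidable_comp:
  assumes "semidecidable m P" and "\<And>i. i < m \<Longrightarrow> recursive k (\<lambda>e. G e i)"
  shows "semidecidable k (\<lambda>e. P (G e))"
proof -
  from assms(1) obtain Q where Q: "decidable (Suc m) (\<lambda>e. Q (e 0) (\<lambda>n. e (Suc n)))"
    and P: "\<And>e. P e \<longleftrightarrow> (\<exists>t. Q t e)"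
    unfolding semidecidable_def by blast
  have "decidable (Suc k) (\<lambda>e. Q (e 0) (G (\<lambda>n. e (Suc n))))"
    by (rule decidable_bind[OF Q]) (simp add: recursive_var, rule recursive_shift, rule assms(2))
  then show ?thesis unfolding semidecidable_def P by (intro exI[of _ "\<lambda>t e. Q t (G e)"]) simp
qed

text \<open>Value and witness are packed into one number, so that a single search finds both.
  Uniformization, enumeration and the passage to programs all start from this form.\<close>

lemma semidecidable_witnessE:
  assumes "semidecidable (Suc k) (\<lambda>e. P (e 0) (\<lambda>n. e (Suc n)))"
  obtains R where "decidable (Suc k) (\<lambda>e. R (e 0) (\<lambda>n. e (Suc n)))"
    and "\<And>v e. P v e \<longleftrightarrow> (\<exists>w. R w e \<and> v = fst (prod_decode w))"
proof -
  from assms obtain Q where Q: "decidable (Suc (Suc k)) (\<lambda>e. Q (e 0) (\<lambda>n. e (Suc n)))"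
    and P: "\<And>v e. P v e \<longleftrightarrow> (\<exists>t. Q t (case_nat v e))" by (rule semidecidableE) (rule that)
  define R where "R w e = Q (snd (prod_decode w)) (case_nat (fst (prod_decode w)) e)" for w e
  have "recursive (Suc k) (\<lambda>e. case_nat (fst (prod_decode (e 0))) (\<lambda>n. e (Suc n)) i)" if "i < Suc k" for i
    using that by (cases i) (simp, intro comp_intros, simp, simp add: recursive_var)
  then have "decidable (Suc k) (\<lambda>e. R (e 0) (\<lambda>n. e (Suc n)))"
    unfolding R_def by (intro decidable_bind[OF Q] comp_intros) simp
  moreover have "P v e \<longleftrightarrow> (\<exists>w. R w e \<and> v = fst (prod_decode w))" for v e
    unfolding P R_def by (metis fst_conv prod_encode_inverse snd_conv)
  ultimately show thesis by (rule that)
qed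

lemma semidecidable_ex:
  assumes "semidecidable (Suc k) (\<lambda>e. P (e 0) (\<lambda>n. e (Suc n)))"
  shows "semidecidable k (\<lambda>e. \<exists>x. P x e)"
proof -
  from assms obtain R where "decidable (Suc k) (\<lambda>e. R (e 0) (\<lambda>n. e (Suc n)))"
    and "\<And>x e. P x e \<longleftrightarrow> (\<exists>w. R w e \<and> x = fst (prod_decode w))"
    by (rule semidecidable_witnessE) (rule that)
  then show ?thesis unfolding semidecidable_def by blast
qed

lemma semidecidable_conj:
  assumes "semidecidable k P1" "semidecidable k P2"
  shows "semidecidable k (\<lambda>e. P1 e \<and> P2 e)"
proof -
  from assms(1) obtain Q1 where Q1: "decidable (Suc k) (\<lambda>e. Q1 (e 0) (\<lambda>n. e (Suc n)))"
    and P1: "\<And>e. P1 e \<longleftrightarrow> (\<exists>t. Q1 t e)"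
    unfolding semidecidable_def by blast
  from assms(2) obtain Q2 where Q2: "decidable (Suc k) (\<lambda>e. Q2 (e 0) (\<lambda>n. e (Suc n)))"
    and P2: "\<And>e. P2 e \<longleftrightarrow> (\<exists>t. Q2 t e)"
    unfolding semidecidable_def by blast
  define R where "R w e \<longleftrightarrow> Q1 (fst (prod_decode w)) e \<and> Q2 (snd (prod_decode w)) e" for w e
  have "decidable (Suc k) (\<lambda>e. R (e 0) (\<lambda>n. e (Suc n)))"
    unfolding R_def by (intro decidable_conj decidable_bind[OF Q1] decidable_bind[OF Q2] comp_intros; simp)
  moreover have "(P1 e \<and> P2 e) \<longleftrightarrow> (\<exists>w. R w e)" for e
    unfolding P1 P2 R_def by (metis fst_conv prod_encode_inverse snd_conv)
  ultimately show ?thesis unfolding semidecidable_def by blast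
qed

text \<open>Finitely many witnesses have a common bound, so the unbounded search can be moved in
  front of the bounded quantifier.\<close>

lemma semidecidable_all:
  assumes N: "recursive k N" and "semidecidable (Suc k) (\<lambda>e. P (e 0) (\<lambda>n. e (Suc n)))"
  shows "semidecidable k (\<lambda>e. \<forall>i<N e. P i e)"
proof -
  from assms(2) obtain Q where Q: "decidable (Suc (Suc k)) (\<lambda>e. Q (e 0) (\<lambda>n. e (Suc n)))"
    and P: "\<And>x e. P x e \<longleftrightarrow> (\<exists>t. Q t (case_nat x e))" by (rule semidecidableE) (rule that)
  define R where "R b e \<longleftrightarrow> (\<forall>i<N e. \<exists>t<b. Q t (case_nat i e))" for b e
  have *: "recursive (Suc (Suc (Suc k))) (\<lambda>e. case_nat (e (Suc 0)) (\<lambda>n. e (Suc (Suc (Suc n)))) i)"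
    if "i < Suc k" for i
    using that by (cases i) (simp_all add: recursive_var)
  have "decidable (Suc k) (\<lambda>e. R (e 0) (\<lambda>n. e (Suc n)))"
    unfolding R_def by (intro decidable_all decidable_ex recursive_shift N decidable_bind[OF Q] recursive_var *) simp_all
  moreover have "(\<forall>i<N e. P i e) \<longleftrightarrow> (\<exists>b. R b e)" for e
  proof
    assume "\<forall>i<N e. P i e"
    then have "\<forall>i. \<exists>t. i < N e \<longrightarrow> Q t (case_nat i e)" unfolding P by blast
    then obtain t where t: "\<forall>i. i < N e \<longrightarrow> Q (t i) (case_nat i e)" by metis
    have "t i < Suc (\<Sum>i<N e. t i)" if "i < N e" for i
      using that by (simp add: less_Suc_eq_le member_le_sum)
    with t show "\<exists>b. R b e" unfolding R_def by blast
  qed (auto simp: R_def P)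
  ultimately show ?thesis unfolding semidecidable_def by blast
qed

text \<open>With a fixed \<open>m\<close>, nothing uniform in \<open>i\<close> is asked for. This
  fits the programs \<open>gs\<close> of a composition, each of which comes with its own induction
  hypothesis.\<close>

lemma semidecidable_all_const:
  fixes m :: nat
  assumes "\<And>i. i < m \<Longrightarrow> semidecidable k (P i)"
  shows "semidecidable k (\<lambda>e. \<forall>i<m. P i e)"
  using assms
proof (induction m)
  case 0
  then show ?case by (simp add: semidecidable_decidable decidable_const)
next
  case (Suc m)
  then have "semidecidable k (\<lambda>e. (\<forall>i<m. P i e) \<and> P m e)" by (intro semidecidable_conj) simp_all
  moreover have "(\<forall>i<m. P i e) \<and> P m e \<longleftrightarrow> (\<forall>i<Suc m. P i e)" for e
    by (auto simp: less_Suc_eq)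
  ultimately show ?case by (simp only:)
qed

section \<open>Evaluation expressed by quantifiers over codes\<close>

lemma eval_Cons_args: "eval f (n # map e [0..<k]) v \<longleftrightarrow> eval f (map (case_nat n e) [0..<Suc k]) v"
  by (simp add: map_upt_Suc del: upt_Suc)

lemma eval_Cons_Cons_args:
  "eval f (n # m # map e [0..<k]) v \<longleftrightarrow> eval f (map (case_nat n (case_nat m e)) [0..<Suc (Suc k)]) v"
  by (simp add: map_upt_Suc del: upt_Suc)

lemma ex_code_nth: "\<exists>c. \<forall>i<n. code_nth c i = s i"
proof -
  have "code_nth (list_encode (map s [0..<n])) i = s i" if "i < n" for i
    using that by (simp add: code_nth_eq)
  then show ?thesis by blast
qed

text \<open>The list of intermediate values is replaced by one number, over which semidecidable
  relations may be quantified.\<close>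

lemma eval_Cn_code_nth:
  "eval (Cn f gs) xs v \<longleftrightarrow>
     (\<exists>c. (\<forall>i<length gs. eval (gs ! i) xs (code_nth c i)) \<and> eval f (map (code_nth c) [0..<length gs]) v)"
  (is "_ \<longleftrightarrow> (\<exists>c. ?P c)")
proof
  assume "eval (Cn f gs) xs v"
  then obtain ys where ys: "length ys = length gs" "\<forall>i<length gs. eval (gs ! i) xs (ys ! i)" "eval f ys v"
    unfolding eval_Cn_iff list_all2_conv_all_nth by auto
  obtain c where c: "\<forall>i<length gs. code_nth c i = ys ! i" using ex_code_nth by blast
  then have map: "map (code_nth c) [0..<length gs] = ys"
    by (intro nth_equalityI) (simp_all add: ys(1))
  have "eval (gs ! i) xs (code_nth c i)" if "i < length gs" for i
    using ys(2)[rule_format, OF that] c[rule_format, OF that] by (simp only:)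
  then show "\<exists>c. ?P c" using ys(3) by (intro exI[of _ c]) (simp only: map, blast)
next
  assume "\<exists>c. ?P c"
  then obtain c where "?P c" ..
  then show "eval (Cn f gs) xs v"
    unfolding eval_Cn_iff
    by (intro exI[of _ "map (code_nth c) [0..<length gs]"]) (simp add: list_all2_conv_all_nth)
qed

lemma eval_Cn_single: "eval (Cn f [g]) xs v \<longleftrightarrow> (\<exists>w. eval g xs w \<and> eval f [w] v)"
  by (force simp: eval_Cn_iff list_all2_Cons1)

text \<open>The trace of intermediate values turns the recursion into one existential and one
  bounded universal quantifier.\<close>

lemma eval_Pr_code_nth:
  "eval (Pr f g) (n # xs) v \<longleftrightarrow>
     (\<exists>c. eval f xs (code_nth c 0) \<and> (\<forall>i<n. eval g (i # code_nth c i # xs) (code_nth c (Suc i))) \<and> code_nth c n = v)"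
proof -
  have "eval (Pr f g) (n # xs) v \<longleftrightarrow>
    (\<exists>s. eval f xs (s 0) \<and> (\<forall>i<n. eval g (i # s i # xs) (s (Suc i))) \<and> s n = v)"
  proof (induction n arbitrary: v)
    case 0
    then show ?case by (auto simp: eval_Pr_0_iff intro: exI[of _ "\<lambda>_. v"])
  next
    case (Suc n)
    show ?case
    proof
      assume "eval (Pr f g) (Suc n # xs) v"
      then obtain y where y: "eval (Pr f g) (n # xs) y" "eval g (n # y # xs) v"
        unfolding eval_Pr_Suc_iff by blast
      from y(1) Suc obtain s where s: "eval f xs (s 0)" "\<forall>i<n. eval g (i # s i # xs) (s (Suc i))" "s n = y"
        by blast
      show "\<exists>s. eval f xs (s 0) \<and> (\<forall>i<Suc n. eval g (i # s i # xs) (s (Suc i))) \<and> s (Suc n) = v"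
        using s y(2) by (intro exI[of _ "s(Suc n := v)"]) (auto simp: less_Suc_eq)
    next
      assume "\<exists>s. eval f xs (s 0) \<and> (\<forall>i<Suc n. eval g (i # s i # xs) (s (Suc i))) \<and> s (Suc n) = v"
      then obtain s where s: "eval f xs (s 0)" "\<forall>i<Suc n. eval g (i # s i # xs) (s (Suc i))" "s (Suc n) = v"
        by blast
      then have "eval (Pr f g) (n # xs) (s n)" unfolding Suc by auto
      with s show "eval (Pr f g) (Suc n # xs) v" unfolding eval_Pr_Suc_iff by blast
    qed
  qed
  also have "\<dots> \<longleftrightarrow> (\<exists>c. eval f xs (code_nth c 0) \<and> (\<forall>i<n. eval g (i # code_nth c i # xs) (code_nth c (Suc i))) \<and> code_nth c n = v)"
    (is "(\<exists>s. ?P s) \<longleftrightarrow> (\<exists>c. ?P (code_nth c))")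
  proof
    assume "\<exists>s. ?P s"
    then obtain s where s: "?P s" ..
    obtain c where "\<forall>i<Suc n. code_nth c i = s i" using ex_code_nth by blast
    with s have "?P (code_nth c)" by simp
    then show "\<exists>c. ?P (code_nth c)" ..
  qed blast
  finally show ?thesis .
qed

text \<open>
  Kleene's normal form, by induction on the program; this replaces the construction of a universal machine.
\<close>

lemma semidecidable_eval:
  assumes "\<And>i. i < k \<Longrightarrow> recursive j (\<lambda>e. X e i)" and "recursive j V"
  shows "semidecidable j (\<lambda>e. eval f (map (X e) [0..<k]) (V e))"
  using assms
\<comment> \<open>Subprograms run on entries of coded traces, so arity, environment and argument
  functions all have to vary in the induction.\<close>
proof (induction f arbitrary: k j X V)
  case Z
  then show ?case by (simp add: eval_Z_iff semidecidable_decidable decidable_eq recursive_const)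
next
  case Suc_f
  show ?case
  proof (cases k)
    case 0
    have "\<not> eval Suc_f [] v" for v by (subst eval.simps) simp
    with 0 show ?thesis by (simp add: semidecidable_decidable decidable_const)
  next
    case (Suc k')
    with Suc_f show ?thesis
      by (simp add: map_upt_Suc eval_Suc_iff semidecidable_decidable decidable_eq recursive_Suc del: upt_Suc)
  qed
next
  case (Proj i)
  show ?case
  proof (cases "i < k")
    case True
    then have "eval (Proj i) (map (X e) [0..<k]) v \<longleftrightarrow> v = X e i" for e v
      by (simp add: eval_Proj_iff)
    then show ?thesis using Proj True by (simp only:) (intro semidecidable_decidable decidable_eq)
  next
    case False
    then show ?thesis by (simp add: eval_Proj_iff semidecidable_decidable decidable_const)
  qed
next
  case (Cn f gs)
  have X: "recursive (Suc j) (\<lambda>e. X (\<lambda>n. e (Suc n)) i)" if "i < k" for i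
    using recursive_shift[OF Cn.prems(1)[OF that]] .
  have g: "semidecidable (Suc j) (\<lambda>e. eval (gs ! i) (map (X (\<lambda>n. e (Suc n))) [0..<k]) (code_nth (e 0) i))"
    if "i < length gs" for i
    by (rule Cn.IH(2)) (use that X in \<open>auto intro: comp_intros\<close>)
  have f: "semidecidable (Suc j) (\<lambda>e. eval f (map (code_nth (e 0)) [0..<length gs]) (V (\<lambda>n. e (Suc n))))"
    by (rule Cn.IH(1)) (auto intro: comp_intros recursive_shift Cn.prems)
  show ?case unfolding eval_Cn_code_nth by (intro semidecidable_ex semidecidable_conj semidecidable_all_const g f)
next
  case (Pr f g)
  show ?case
  proof (cases k)
    case 0
    have "\<not> eval (Pr f g) [] v" for v by (subst eval.simps) simp
    with 0 show ?thesis by (simp add: semidecidable_decidable decidable_const)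
  next
    case (Suc k')
    have X: "recursive j (\<lambda>e. X e 0)" "\<And>i. i < k' \<Longrightarrow> recursive j (\<lambda>e. X e (Suc i))"
      using Pr.prems(1) Suc by auto
    have f: "semidecidable (Suc j) (\<lambda>e. eval f (map (\<lambda>i. X (\<lambda>n. e (Suc n)) (Suc i)) [0..<k']) (code_nth (e 0) 0))"
      by (intro Pr.IH(1) comp_intros recursive_shift[OF X(2)]) auto
    have g: "semidecidable (Suc (Suc j)) (\<lambda>e. eval g (map (case_nat (e 0) (case_nat (code_nth (e (Suc 0)) (e 0))
        (\<lambda>i. X (\<lambda>n. e (Suc (Suc n))) (Suc i)))) [0..<Suc (Suc k')]) (code_nth (e (Suc 0)) (Suc (e 0))))"
    proof (rule Pr.IH(2))
      fix i assume "i < Suc (Suc k')"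
      then consider "i = 0" | "i = Suc 0" | i' where "i = Suc (Suc i')" "i' < k'"
        by (metis Suc_less_eq old.nat.exhaust)
      then show "recursive (Suc (Suc j)) (\<lambda>e. case_nat (e 0) (case_nat (code_nth (e (Suc 0)) (e 0))
          (\<lambda>i. X (\<lambda>n. e (Suc (Suc n))) (Suc i))) i)"
      proof cases
        case 3
        then show ?thesis
          using recursive_shift[OF recursive_shift[OF X(2)[OF 3(2)]]] by simp
      qed (simp; intro comp_intros; simp)+
    qed (intro comp_intros; simp)+
    have "semidecidable j (\<lambda>e. \<exists>c. eval f (map (\<lambda>i. X e (Suc i)) [0..<k']) (code_nth c 0) \<and>
        (\<forall>i<X e 0. eval g (i # code_nth c i # map (\<lambda>i. X e (Suc i)) [0..<k']) (code_nth c (Suc i))) \<and>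
        code_nth c (X e 0) = V e)"
      unfolding eval_Cons_Cons_args
      by (intro semidecidable_ex semidecidable_conj semidecidable_all f g semidecidable_decidable decidable_eq recursive_code_nth recursive_var recursive_shift X(1) Pr.prems(2)) simp_all
    then show ?thesis
      unfolding Suc by (simp add: map_upt_Suc eval_Pr_code_nth del: upt_Suc)
  qed
next
  case (Mn f)
  have f0: "semidecidable j (\<lambda>e. eval f (map (case_nat (V e) (X e)) [0..<Suc k]) 0)"
  proof (rule Mn.IH)
    show "recursive j (\<lambda>e. case_nat (V e) (X e) i)" if "i < Suc k" for i
      using that Mn.prems by (cases i) simp_all
  qed (intro comp_intros)
  have f1: "semidecidable (Suc (Suc j)) (\<lambda>e. eval f (map (case_nat (e (Suc 0)) (X (\<lambda>n. e (Suc (Suc n))))) [0..<Suc k]) (Suc (e 0)))"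
  proof (rule Mn.IH)
    fix i assume "i < Suc k"
    then show "recursive (Suc (Suc j)) (\<lambda>e. case_nat (e (Suc 0)) (X (\<lambda>n. e (Suc (Suc n)))) i)"
    proof (cases i)
      case (Suc i')
      then show ?thesis
        using \<open>i < Suc k\<close> recursive_shift[OF recursive_shift[OF Mn.prems(1)[of i']]] by simp
    qed (simp add: recursive_var)
  qed (intro comp_intros; simp)
  show ?case
    unfolding eval_Mn_iff eval_Cons_args
    by (intro semidecidable_conj semidecidable_all semidecidable_ex f0 f1 Mn.prems(2))
qed

section \<open>Programs and choice functions from semidecidable relations\<close>

text \<open>The program searches for the least code of a value with a witness; uniqueness ensures
  that the pair found first carries the right value.\<close>

lemma semidecidable_fun_computable:
  assumes "semidecidable (Suc k) (\<lambda>e. G (e 0) (\<lambda>n. e (Suc n)))"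
    and unique: "\<And>v w e. G v e \<Longrightarrow> G w e \<Longrightarrow> v = w"
  shows "\<exists>f. \<forall>e v. eval f (map e [0..<k]) v \<longleftrightarrow> G v e"
proof -
  from assms(1) obtain R where R: "decidable (Suc k) (\<lambda>e. R (e 0) (\<lambda>n. e (Suc n)))"
    and GR: "\<And>v e. G v e \<longleftrightarrow> (\<exists>w. R w e \<and> v = fst (prod_decode w))"
    by (rule semidecidable_witnessE) (rule that)
  from decidable_not[OF R] obtain r where
    "\<And>e v. eval r (map e [0..<Suc k]) v \<longleftrightarrow> v = of_bool (\<not> R (e 0) (\<lambda>n. e (Suc n)))"
    unfolding recursive_def decidable_def by blast
  from this[of "case_nat w e" for w e]
  have r: "eval r (w # map e [0..<k]) v \<longleftrightarrow> v = of_bool (\<not> R w e)" for w e v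
    by (simp add: map_upt_Suc del: upt_Suc)
  have "recursive 1 (\<lambda>e. fst (prod_decode (e 0)))" by (intro comp_intros) simp
  then obtain p where "\<And>e v. eval p (map e [0..<1]) v \<longleftrightarrow> v = fst (prod_decode (e 0))"
    unfolding recursive_def by blast
  from this[of "\<lambda>_. x" for x] have p: "eval p [x] v \<longleftrightarrow> v = fst (prod_decode x)" for x v
    by simp
  have mn: "eval (Mn r) (map e [0..<k]) w \<longleftrightarrow> R w e \<and> (\<forall>w'<w. \<not> R w' e)" for e w
    by (auto simp: eval_Mn_iff r of_bool_def)
  have "eval (Cn p [Mn r]) (map e [0..<k]) v \<longleftrightarrow> G v e" for e v
  proof -
    have "eval (Cn p [Mn r]) (map e [0..<k]) v \<longleftrightarrow>
        (\<exists>w. R w e \<and> (\<forall>w'<w. \<not> R w' e) \<and> v = fst (prod_decode w))"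
      by (simp only: eval_Cn_single mn p) blast
    also have "\<dots> \<longleftrightarrow> G v e"
    proof
      assume "G v e"
      then obtain w where w: "R w e" "v = fst (prod_decode w)" unfolding GR by blast
      define u where "u = (LEAST u. R u e)"
      have u: "R u e" "\<forall>w'<u. \<not> R w' e"
        unfolding u_def using w(1) by (auto intro: LeastI dest: not_less_Least)
      then have "G (fst (prod_decode u)) e" unfolding GR by blast
      then have "v = fst (prod_decode u)" using \<open>G v e\<close> unique by blast
      with u show "\<exists>w. R w e \<and> (\<forall>w'<w. \<not> R w' e) \<and> v = fst (prod_decode w)" by blast
    qed (auto simp: GR)
    finally show ?thesis .
  qed
  then show ?thesis by blast
qed

text \<open>The value belonging to the least pair of value and witness is selected. Minimality stays
  decidable because it only negates the decidable matrix \<open>R\<close> below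
  \<open>w\<close>.\<close>

lemma semidecidable_uniformization:
  assumes "semidecidable (Suc k) (\<lambda>e. P (e 0) (\<lambda>n. e (Suc n)))"
  obtains S where "semidecidable (Suc k) (\<lambda>e. S (e 0) (\<lambda>n. e (Suc n)))"
    and "\<And>v e. S v e \<Longrightarrow> P v e" and "\<And>v e. P v e \<Longrightarrow> \<exists>w. S w e"
    and "\<And>v w e. S v e \<Longrightarrow> S w e \<Longrightarrow> v = w"
proof -
  from assms obtain R where R: "decidable (Suc k) (\<lambda>e. R (e 0) (\<lambda>n. e (Suc n)))"
    and PR: "\<And>v e. P v e \<longleftrightarrow> (\<exists>w. R w e \<and> v = fst (prod_decode w))"
    by (rule semidecidable_witnessE) (rule that)
  define S where "S v e \<longleftrightarrow> (\<exists>w. v = fst (prod_decode w) \<and> R w e \<and> (\<forall>w'<w. \<not> R w' e))" for v e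
  show thesis
  proof
    have "decidable (Suc (Suc k)) (\<lambda>e. R (e 0) (\<lambda>n. e (Suc (Suc n))))"
      and "decidable (Suc (Suc (Suc k))) (\<lambda>e. R (e 0) (\<lambda>n. e (Suc (Suc (Suc n)))))"
      by (rule decidable_bind[OF R]; simp add: recursive_var)+
    then show "semidecidable (Suc k) (\<lambda>e. S (e 0) (\<lambda>n. e (Suc n)))"
      unfolding S_def by (intro semidecidable_ex semidecidable_decidable comp_intros) simp_all
    show "P v e" if "S v e" for v e
      using that unfolding S_def PR by blast
    show "\<exists>w. S w e" if "P v e" for v e
    proof -
      from that obtain w where w: "R w e" unfolding PR by blast
      have "R (LEAST w. R w e) e" "\<forall>w'<(LEAST w. R w e). \<not> R w' e"
        using w by (auto intro: LeastI dest: not_less_Least)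
      then show ?thesis unfolding S_def by blast
    qed
    show "v = w" if "S v e" "S w e" for v w e
      using that unfolding S_def by (metis linorder_neqE_nat)
  qed
qed

subsection \<open>Counting and enumerating semidecidable sets\<close>

text \<open>A lower bound on a cardinality is confirmed at a finite stage \<open>b\<close>, once
  enough elements with witnesses have appeared below \<open>b\<close>. Finiteness matters because
  \<open>card\<close> of an infinite set is 0.\<close>

lemma semidecidable_card:
  assumes N: "recursive k N" and "semidecidable (Suc k) (\<lambda>e. P (e 0) (\<lambda>n. e (Suc n)))"
    and fin: "\<And>e. finite {x. P x e}"
  shows "semidecidable k (\<lambda>e. N e \<le> card {x. P x e})"
proof -
  from assms(2) obtain Q where Q: "decidable (Suc (Suc k)) (\<lambda>e. Q (e 0) (\<lambda>n. e (Suc n)))"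
    and P: "\<And>x e. P x e \<longleftrightarrow> (\<exists>t. Q t (case_nat x e))" by (rule semidecidableE) (rule that)
  define R where "R b e \<longleftrightarrow> N e \<le> card {i. i < b \<and> (\<exists>t<b. Q t (case_nat i e))}" for b e
  have *: "recursive (Suc (Suc (Suc k))) (\<lambda>e. case_nat (e (Suc 0)) (\<lambda>n. e (Suc (Suc (Suc n)))) i)"
    if "i < Suc k" for i
    using that by (cases i) (simp_all add: recursive_var)
  have "decidable (Suc k) (\<lambda>e. R (e 0) (\<lambda>n. e (Suc n)))"
    unfolding R_def by (intro decidable_le recursive_card decidable_ex recursive_shift N decidable_bind[OF Q] recursive_var *) simp_all
  moreover have "N e \<le> card {x. P x e} \<longleftrightarrow> (\<exists>b. R b e)" for e
  proof
    assume N: "N e \<le> card {x. P x e}"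
    have "\<forall>x. \<exists>t. P x e \<longrightarrow> Q t (case_nat x e)" unfolding P by blast
    from choice[OF this] obtain t where t: "\<forall>x. P x e \<longrightarrow> Q (t x) (case_nat x e)" ..
    \<comment> \<open>One bound above all elements and all their chosen witnesses.\<close>
    define b where "b = Suc (\<Sum>x | P x e. x + t x)"
    have b: "x < b \<and> t x < b" if "P x e" for x
    proof -
      have "x + t x \<le> (\<Sum>x | P x e. x + t x)"
        using member_le_sum[of x "{x. P x e}" "\<lambda>x. x + t x"] that fin by simp
      then show ?thesis unfolding b_def by linarith
    qed
    have "card {x. P x e} \<le> card {i. i < b \<and> (\<exists>t<b. Q t (case_nat i e))}"
      by (rule card_mono) (use b t in auto)
    with N show "\<exists>b. R b e" unfolding R_def by (blast intro: order_trans)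
  next
    assume "\<exists>b. R b e"
    then obtain b where "R b e" ..
    moreover have "card {i. i < b \<and> (\<exists>t<b. Q t (case_nat i e))} \<le> card {x. P x e}"
      by (rule card_mono[OF fin]) (auto simp: P)
    ultimately show "N e \<le> card {x. P x e}" unfolding R_def by linarith
  qed
  ultimately show ?thesis unfolding semidecidable_def by blast
qed

lemma card_below_less:
  fixes S :: "nat set"
  assumes "finite S" "u \<in> S" "u < v"
  shows "card {c \<in> S. c < u} < card {c \<in> S. c < v}"
  by (rule psubset_card_mono) (use assms in auto)

text \<open>The rank is injective from \<open>S\<close> into an initial segment of the same size,
  hence onto it.\<close>

lemma ex_card_below:
  fixes S :: "nat set"
  assumes "finite S" "i < card S"
  shows "\<exists>u\<in>S. card {c \<in> S. c < u} = i"
proof -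
  let ?f = "\<lambda>u. card {c \<in> S. c < u}"
  have "inj_on ?f S"
    by (rule linorder_inj_onI) (use card_below_less[OF assms(1)] in fastforce)+
  then have "card (?f ` S) = card {..<card S}" by (simp add: card_image)
  moreover have "?f ` S \<subseteq> {..<card S}"
  proof
    fix j assume "j \<in> ?f ` S"
    then obtain u where u: "u \<in> S" "j = ?f u" by blast
    have "?f u < card S" by (rule psubset_card_mono) (use assms u in auto)
    with u show "j \<in> {..<card S}" by simp
  qed
  ultimately have "?f ` S = {..<card S}" by (intro card_subset_eq) simp_all
  with assms(2) show ?thesis by (metis (no_types, lifting) imageE lessThan_iff)
qed

text \<open>
  The index of \<open>z\<close> is the rank of its least witness among the least witnesses of all elements; this
  makes the enumeration injective without a stage-by-stage simulation.
\<close>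

lemma semidecidable_enumeration:
  assumes "semidecidable (Suc k) (\<lambda>e. P (e 0) (\<lambda>n. e (Suc n)))"
  obtains E where "semidecidable (Suc (Suc k)) (\<lambda>e. E (e 0) (e (Suc 0)) (\<lambda>n. e (Suc (Suc n))))"
    and "\<And>i z e. E i z e \<Longrightarrow> P z e"
    and "\<And>i y z e. E i y e \<Longrightarrow> E i z e \<Longrightarrow> y = z"
    and "\<And>z e. finite {z. P z e} \<Longrightarrow> P z e \<Longrightarrow> \<exists>i<card {z. P z e}. E i z e"
proof -
  from assms obtain R where R: "decidable (Suc k) (\<lambda>e. R (e 0) (\<lambda>n. e (Suc n)))"
    and PR: "\<And>v e. P v e \<longleftrightarrow> (\<exists>w. R w e \<and> v = fst (prod_decode w))"
    by (rule semidecidable_witnessE) (rule that)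
  define F where "F w e \<longleftrightarrow> R w e \<and> (\<forall>w'<w. fst (prod_decode w') = fst (prod_decode w) \<longrightarrow> \<not> R w' e)"
    for w e
  have "decidable (Suc k) (\<lambda>e. R (e 0) (\<lambda>n. e (Suc n)) \<and>
      (\<forall>w'<e 0. \<not> (fst (prod_decode w') = fst (prod_decode (e 0)) \<and> R w' (\<lambda>n. e (Suc n)))))"
  proof -
    have "decidable (Suc (Suc k)) (\<lambda>e. R (e 0) (\<lambda>n. e (Suc (Suc n))))"
      by (rule decidable_bind[OF R]; simp add: recursive_var)
    with R show ?thesis by (intro comp_intros) simp_all
  qed
  then have F: "decidable (Suc k) (\<lambda>e. F (e 0) (\<lambda>n. e (Suc n)))" by (simp add: F_def)
  have F_inj: "w = w'" if "F w e" "F w' e" "fst (prod_decode w) = fst (prod_decode w')" for w w' e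
    using that unfolding F_def by (metis linorder_neqE_nat)
  have F_ex: "\<exists>w. F w e \<and> z = fst (prod_decode w)" if "P z e" for z e
  proof -
    let ?p = "\<lambda>w. R w e \<and> z = fst (prod_decode w)"
    from that have "?p (LEAST w. ?p w)" unfolding PR by (rule LeastI_ex)
    moreover have "\<not> ?p w'" if "w' < (LEAST w. ?p w)" for w' using that by (rule not_less_Least)
    ultimately show ?thesis unfolding F_def by metis
  qed
  define E where "E i z e \<longleftrightarrow>
    (\<exists>w. z = fst (prod_decode w) \<and> F w e \<and> i = card {w'. w' < w \<and> F w' e})" for i z e
  show thesis
  proof
    have "decidable (Suc (Suc (Suc k))) (\<lambda>e. F (e 0) (\<lambda>n. e (Suc (Suc (Suc n)))))"
      and "decidable (Suc (Suc (Suc (Suc k)))) (\<lambda>e. F (e 0) (\<lambda>n. e (Suc (Suc (Suc (Suc n))))))"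
      by (rule decidable_bind[OF F]; simp add: recursive_var)+
    then show "semidecidable (Suc (Suc k)) (\<lambda>e. E (e 0) (e (Suc 0)) (\<lambda>n. e (Suc (Suc n))))"
      unfolding E_def by (intro semidecidable_ex semidecidable_decidable comp_intros) simp_all
    show "P z e" if "E i z e" for i z e
      using that unfolding E_def F_def PR by blast
    show "y = z" if "E i y e" "E i z e" for i y z e
    proof -
      from that obtain w w' where w: "y = fst (prod_decode w)" "F w e" "i = card {c. c < w \<and> F c e}"
        and w': "z = fst (prod_decode w')" "F w' e" "i = card {c. c < w' \<and> F c e}"
        unfolding E_def by blast
      have less: "card {c. c < u \<and> F c e} < card {c. c < v \<and> F c e}" if "F u e" "u < v" for u v
        by (rule psubset_card_mono) (use that in auto)
      have "w = w'"
        using less[of w w'] less[of w' w] w w' by (metis less_irrefl linorder_neqE_nat)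
      with w w' show ?thesis by simp
    qed
    show "\<exists>i<card {z. P z e}. E i z e" if fin: "finite {z. P z e}" and "P z e" for z e
    proof -
      from F_ex[OF that(2)] obtain w where w: "F w e" "z = fst (prod_decode w)" by blast
      \<comment> \<open>\<open>F\<close> keeps one witness per value, so the ranks of these
        witnesses stay below the number of values.\<close>
      have inj: "inj_on (\<lambda>w. fst (prod_decode w)) {w. F w e}"
        by (auto intro!: inj_onI F_inj)
      have sub: "(\<lambda>w. fst (prod_decode w)) ` {w. F w e} \<subseteq> {z. P z e}"
        unfolding PR F_def by blast
      have "card {c. c < w \<and> F c e} < card {w. F w e}"
        by (rule psubset_card_mono) (use w inj_on_finite[OF inj sub fin] in auto)
      also have "\<dots> \<le> card {z. P z e}" by (rule card_inj_on_le[OF inj sub fin])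
      finally show ?thesis using w unfolding E_def by blast
    qed
  qed
qed

section \<open>Machines given by their graphs\<close>

lemma semidecidable_machine:
  assumes "computable1 U" "recursive_str k F" "recursive_str k G"
  shows "semidecidable k (\<lambda>e. U (F e) = Some (G e))"
proof -
  from assms(1) obtain f where "\<And>p v. eval f [str_code p] v \<longleftrightarrow> (\<exists>x. U p = Some x \<and> v = str_code x)"
    unfolding computable1_def by blast
  then have "eval f (map (\<lambda>i. str_code p) [0..<1]) (str_code x) \<longleftrightarrow> U p = Some x" for p x by simp
  moreover have "semidecidable k (\<lambda>e. eval f (map (\<lambda>i. str_code (F e)) [0..<1]) (str_code (G e)))"
    by (intro semidecidable_eval comp_intros assms)
  ultimately show ?thesis by (simp only:)
qed

text \<open>Parsing and searching may hide in existential quantifiers of \<open>R\<close>; what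
  remains to be checked for a machine is that its output is unique.\<close>

lemma ex_computable1:
  assumes "semidecidable (Suc (Suc 0)) (\<lambda>e. R (str_decode (e (Suc 0))) (str_decode (e 0)))"
    and "\<And>p x y. R p x \<Longrightarrow> R p y \<Longrightarrow> x = y"
  obtains M where "computable1 M" and "\<And>p x. R p x \<Longrightarrow> M p = Some x"
proof -
  define G where "G v e \<longleftrightarrow> v = str_code (str_decode v) \<and> R (str_decode (e 0)) (str_decode v)" for v and e :: "nat \<Rightarrow> nat"
  have "\<exists>f. \<forall>e v. eval f (map e [0..<Suc 0]) v \<longleftrightarrow> G v e"
  proof (rule semidecidable_fun_computable)
    show "semidecidable (Suc (Suc 0)) (\<lambda>e. G (e 0) (\<lambda>n. e (Suc n)))"
      unfolding G_def by (intro semidecidable_conj assms(1) semidecidable_decidable comp_intros; simp)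
    show "v = w" if "G v e" "G w e" for v w e
      using that assms(2) unfolding G_def by metis
  qed
  then obtain f where "\<And>e v. eval f (map e [0..<Suc 0]) v \<longleftrightarrow> G v e" by blast
  from this[of "\<lambda>_. str_code p" for p]
  have f: "eval f [str_code p] v \<longleftrightarrow> v = str_code (str_decode v) \<and> R p (str_decode v)" for p v
    by (simp add: G_def)
  define M where "M p = (if \<exists>x. R p x then Some (THE x. R p x) else None)" for p
  have "(THE x. R p x) = x" if "R p x" for p x
    using that assms(2) by blast
  then have M: "M p = Some x \<longleftrightarrow> R p x" for p x unfolding M_def by auto
  have "v = str_code (str_decode v) \<and> R p (str_decode v) \<longleftrightarrow> (\<exists>x. R p x \<and> v = str_code x)" for p v
    by (rule iffI; clarsimp) (rule exI[of _ "str_decode v"], simp)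
  then have "computable1 M"
    unfolding computable1_def by (intro exI[of _ f]) (simp only: f M simp_thms)
  with M show thesis using that by blast
qed

lemma ex_computable2:
  assumes "semidecidable (Suc (Suc (Suc 0))) (\<lambda>e. R (str_decode (e (Suc 0))) (str_decode (e (Suc (Suc 0)))) (str_decode (e 0)))"
    and "\<And>p y x x'. R p y x \<Longrightarrow> R p y x' \<Longrightarrow> x = x'"
  obtains M where "computable2 M" and "\<And>p y x. R p y x \<Longrightarrow> M p y = Some x"
proof -
  define G where "G v e \<longleftrightarrow> v = str_code (str_decode v) \<and> R (str_decode (e 0)) (str_decode (e (Suc 0))) (str_decode v)"
    for v and e :: "nat \<Rightarrow> nat"
  have "\<exists>f. \<forall>e v. eval f (map e [0..<Suc (Suc 0)]) v \<longleftrightarrow> G v e"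
  proof (rule semidecidable_fun_computable)
    show "semidecidable (Suc (Suc (Suc 0))) (\<lambda>e. G (e 0) (\<lambda>n. e (Suc n)))"
      unfolding G_def by (intro semidecidable_conj assms(1) semidecidable_decidable comp_intros; simp)
    show "v = w" if "G v e" "G w e" for v w e
      using that assms(2) unfolding G_def by metis
  qed
  then obtain f where "\<And>e v. eval f (map e [0..<Suc (Suc 0)]) v \<longleftrightarrow> G v e" by blast
  from this[of "case_nat (str_code p) (\<lambda>_. str_code y)" for p y]
  have f: "eval f [str_code p, str_code y] v \<longleftrightarrow> v = str_code (str_decode v) \<and> R p y (str_decode v)" for p y v
    by (simp add: G_def)
  define M where "M p y = (if \<exists>x. R p y x then Some (THE x. R p y x) else None)" for p y
  have "(THE x. R p y x) = x" if "R p y x" for p y x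
    using that assms(2) by blast
  then have M: "M p y = Some x \<longleftrightarrow> R p y x" for p y x unfolding M_def by auto
  have "v = str_code (str_decode v) \<and> R p y (str_decode v) \<longleftrightarrow> (\<exists>x. R p y x \<and> v = str_code x)" for p y v
    by (rule iffI; clarsimp) (rule exI[of _ "str_decode v"], simp)
  then have "computable2 M"
    unfolding computable2_def by (intro exI[of _ f]) (simp only: f M simp_thms)
  with M show thesis using that by blast
qed

text \<open>
  Numbers below \<open>2 ^ b\<close> are written as strings of length \<open>b\<close> by rank with respect to \<open>str_code\<close>, which
  avoids binary arithmetic.
\<close>

definition str_rank :: "bool list \<Rightarrow> nat" where
  "str_rank u = card {c. c < str_code u \<and> (str_code (str_decode c) = c \<and> length (str_decode c) = length u)}"

lemma recursive_str_rank [comp_intros]: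
  assumes "recursive_str k F" shows "recursive k (\<lambda>e. str_rank (F e))"
proof -
  have "recursive 1 (\<lambda>e. str_rank (str_decode (e 0)))"
    unfolding str_rank_def by (intro comp_intros; simp)
  from recursive_comp1[OF this recursive_str_code[OF assms]] show ?thesis by simp
qed

lemma card_strings: "card {u :: bool list. length u = b} = 2 ^ b"
  and finite_strings: "finite {u :: bool list. length u = b}"
  using card_lists_length_eq[of "UNIV :: bool set" b] finite_lists_length_eq[of "UNIV :: bool set" b]
  by simp_all

lemma codes_eq_image: "{c. str_code (str_decode c) = c \<and> P (str_decode c)} = str_code ` {s. P s}"
  by (auto simp: image_iff) (metis)

lemma card_codes: "card {c. str_code (str_decode c) = c \<and> P (str_decode c)} = card {s. P s}"
  unfolding codes_eq_image by (rule card_image) (simp add: inj_on_def)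

lemma ex_str_rank:
  assumes "i < 2 ^ b"
  shows "\<exists>u. length u = b \<and> str_rank u = i"
proof -
  let ?S = "str_code ` {u. length u = b}"
  have "card ?S = 2 ^ b" by (subst card_image) (simp_all add: inj_on_def card_strings)
  with assms ex_card_below[of ?S i] obtain u where u: "length u = b" "card {c \<in> ?S. c < str_code u} = i"
    by (auto simp: finite_strings)
  have "{c \<in> ?S. c < str_code u} =
      {c. c < str_code u \<and> (str_code (str_decode c) = c \<and> length (str_decode c) = length u)}"
    unfolding codes_eq_image[of "\<lambda>s. length s = b", symmetric] using u(1) by auto
  with u show ?thesis unfolding str_rank_def by auto
qed

text \<open>The first \<open>False\<close> ends the block, so such a header is
  self-delimiting.\<close>

lemma replicate_True_inject:
  "replicate b True @ False # s = replicate b' True @ False # s' \<longleftrightarrow> b = b' \<and> s = s'"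
proof (induction b arbitrary: b')
  case 0
  then show ?case by (cases b') auto
next
  case (Suc b)
  then show ?case by (cases b') auto
qed

subsection \<open>The two machines\<close>

text \<open>
  The program \<open>p\<close> must be independent of \<open>u\<close> and \<open>r\<close>: the machine uses one semidecidable choice of a
  program of \<open>x\<close> of given length, so all its outputs extend a prefix of the same \<open>p\<close>.
\<close>

lemma ex_cond_machine:
  assumes "computable1 U"
  obtains W where "computable2 W"
    and "\<And>q x. U q = Some x \<Longrightarrow> \<exists>p. length p = length q \<and> U p = Some x \<and>
      (\<forall>u z w r. str_rank u = length p \<longrightarrow> p = z @ w \<longrightarrow> length z + length r = length x \<longrightarrow>
        W (replicate (length u) True @ False # u @ r) x = Some (z @ r))"
proof -
  have "semidecidable (Suc (Suc (Suc 0)))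
      (\<lambda>e. U (str_decode (e 0)) = Some (str_decode (e (Suc (Suc 0)))) \<and> length (str_decode (e 0)) = e (Suc 0))"
    by (intro semidecidable_conj semidecidable_machine[OF assms] semidecidable_decidable comp_intros) simp_all
  then obtain S where S: "semidecidable (Suc (Suc (Suc 0))) (\<lambda>e. S (e 0) (\<lambda>n. e (Suc n)))"
    and S_imp: "\<And>v e. S v e \<Longrightarrow> U (str_decode v) = Some (str_decode (e (Suc 0))) \<and> length (str_decode v) = e 0"
    and S_ex: "\<And>v e. U (str_decode v) = Some (str_decode (e (Suc 0))) \<and> length (str_decode v) = e 0 \<Longrightarrow> \<exists>w. S w e"
    and S_unique: "\<And>v w e. S v e \<Longrightarrow> S w e \<Longrightarrow> v = w"
    by (rule semidecidable_uniformization[where P = "\<lambda>v e. U (str_decode v) = Some (str_decode (e (Suc 0))) \<and> length (str_decode v) = e 0"])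
      (rule that)
  have semidecidable_S: "semidecidable k (\<lambda>e. S (V e) (case_nat (K e) (\<lambda>_. X e)))"
    if "recursive k V" "recursive k K" "recursive k X" for k V K X
  proof -
    have "recursive k (\<lambda>e. case_nat (V e) (case_nat (K e) (\<lambda>_. X e)) i)" for i
      using that by (cases i; cases "i - 1") simp_all
    from semidecidable_comp[OF S, of k "\<lambda>e. case_nat (V e) (case_nat (K e) (\<lambda>_. X e))", OF this]
    show ?thesis by simp
  qed
  \<comment> \<open>The place where \<open>v\<close> is cut is not part of the program: the lengths
    of \<open>x\<close> and \<open>r\<close> determine the length of \<open>z\<close>.\<close>
  define R where "R q x y \<longleftrightarrow> (\<exists>b u r z w v.
    q = replicate b True @ [False] @ str_decode u @ str_decode r \<and> length (str_decode u) = b \<and>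
    str_decode v = str_decode z @ str_decode w \<and> y = str_decode z @ str_decode r \<and> length y = length x \<and>
    S v (case_nat (str_rank (str_decode u)) (\<lambda>_. str_code x)))" for q x y
  obtain W where W: "computable2 W" "\<And>q x y. R q x y \<Longrightarrow> W q x = Some y"
  proof (rule ex_computable2)
    show "semidecidable (Suc (Suc (Suc 0))) (\<lambda>e. R (str_decode (e (Suc 0))) (str_decode (e (Suc (Suc 0)))) (str_decode (e 0)))"
      unfolding R_def by (intro semidecidable_ex semidecidable_conj semidecidable_S semidecidable_decidable comp_intros; simp)
    show "y = y'" if y: "R q x y" and y': "R q x y'" for q x y y'
    proof -
      from y obtain u r z w v where 1:
        "q = replicate (length (str_decode u)) True @ False # str_decode u @ str_decode r"
        "str_decode v = str_decode z @ str_decode w" "y = str_decode z @ str_decode r" "length y = length x"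
        "S v (case_nat (str_rank (str_decode u)) (\<lambda>_. str_code x))"
        unfolding R_def by auto
      from y' obtain u' r' z' w' v' where 2:
        "q = replicate (length (str_decode u')) True @ False # str_decode u' @ str_decode r'"
        "str_decode v' = str_decode z' @ str_decode w'" "y' = str_decode z' @ str_decode r'" "length y' = length x"
        "S v' (case_nat (str_rank (str_decode u')) (\<lambda>_. str_code x))"
        unfolding R_def by auto
      from 1(1) 2(1) have ur: "str_decode u = str_decode u'" "str_decode r = str_decode r'"
        unfolding replicate_True_inject by (metis append_eq_append_conv replicate_True_inject)+
      with 1(5) 2(5) S_unique have "v = v'" by metis
      with 1(2-4) 2(2-4) ur show ?thesis by (metis add_right_cancel append_eq_append_conv length_append)
    qed
  qed (rule that)
  show thesis
  proof
    show "computable2 W" by fact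
    fix q x assume "U q = Some x"
    then obtain v where v: "S v (case_nat (length q) (\<lambda>_. str_code x))"
      using S_ex[of "str_code q" "case_nat (length q) (\<lambda>_. str_code x)"] by auto
    have "W (replicate (length u) True @ False # u @ r) x = Some (z @ r)"
      if "str_rank u = length (str_decode v)" "str_decode v = z @ w" "length z + length r = length x" for u z w r
      by (rule W(2), unfold R_def, intro exI[of _ "length u"] exI[of _ "str_code u"] exI[of _ "str_code r"]
          exI[of _ "str_code z"] exI[of _ "str_code w"] exI[of _ v])
        (use that v S_imp[OF v] in simp)
    then show "\<exists>p. length p = length q \<and> U p = Some x \<and>
      (\<forall>u z w r. str_rank u = length p \<longrightarrow> p = z @ w \<longrightarrow> length z + length r = length x \<longrightarrow>
        W (replicate (length u) True @ False # u @ r) x = Some (z @ r))"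
      using S_imp[OF v] by (intro exI[of _ "str_decode v"] conjI allI impI) simp_all
  qed
qed

text \<open>Speaking of programs rather than of \<open>KC\<close> makes membership semidecidable and
  lets the set be counted by programs.\<close>

definition describable :: "(bool list \<Rightarrow> bool list option) \<Rightarrow> nat \<Rightarrow> bool list set" where
  "describable U m = {y. \<exists>q. length q < m \<and> U q = Some y}"

lemma finite_describable: "finite (describable U m)"
  and card_describable: "card (describable U m) < 2 ^ m"
proof -
  have fin: "finite {q :: bool list. length q < m}" and card: "card {q :: bool list. length q < m} < 2 ^ m" for m
  proof (induction m)
    case (Suc m)
    have eq: "{q :: bool list. length q < Suc m} = {q. length q < m} \<union> {q. length q = m}"
      by auto
    { case 1 show ?case unfolding eq using Suc finite_strings by simp }
    { case 2 show ?case unfolding eq using Suc finite_strings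
        by (subst card_Un_disjoint) (auto simp: card_strings) }
  qed simp_all
  have sub: "describable U m \<subseteq> (\<lambda>q. the (U q)) ` {q. length q < m}"
    unfolding describable_def by force
  from finite_subset[OF sub] fin show "finite (describable U m)" by blast
  have "card (describable U m) \<le> card {q :: bool list. length q < m}"
    by (rule surj_card_le[OF fin sub])
  with card[of m] show "card (describable U m) < 2 ^ m" by linarith
qed

text \<open>
  The threshold \<open>2 ^ (d - 1)\<close> is half of the \<open>2 ^ d\<close> extensions, rounded up when \<open>d = 0\<close>.
\<close>

lemma card_rich_prefixes:
  fixes U :: "bool list \<Rightarrow> bool list option" and d m :: nat
  defines "L \<equiv> \<lambda>z. {r. length r = d \<and> z @ r \<in> describable U m}"
  shows "card {z. length z = l \<and> 2 ^ (d - 1) \<le> card (L z)} * 2 ^ (d - 1) < 2 ^ m"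
proof -
  let ?Z = "{z. length z = l \<and> 2 ^ (d - 1) \<le> card (L z)}"
  have finZ: "finite ?Z" by (rule finite_subset[OF _ finite_strings[of l]]) auto
  have finL: "finite (L z)" for z
    unfolding L_def by (rule finite_subset[OF _ finite_strings[of d]]) auto
  have "card ?Z * 2 ^ (d - 1) = (\<Sum>z\<in>?Z. 2 ^ (d - 1))" by simp
  also have "\<dots> \<le> (\<Sum>z\<in>?Z. card (L z))" by (rule sum_mono) simp
  also have "\<dots> = card (SIGMA z:?Z. L z)" by (rule card_SigmaI[symmetric]) (use finZ finL in blast)+
  also have "\<dots> \<le> card (describable U m)"
  \<comment> \<open>All \<open>z\<close> have the same length, so a concatenation determines its two
    parts.\<close>
  proof (rule card_inj_on_le[where f = "\<lambda>(z, r). z @ r"])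
    show "inj_on (\<lambda>(z, r). z @ r) (SIGMA z:?Z. L z)" by (auto simp: inj_on_def)
    show "(\<lambda>(z, r). z @ r) ` (SIGMA z:?Z. L z) \<subseteq> describable U m" by (auto simp: L_def)
  qed (rule finite_describable)
  also note card_describable
  finally show ?thesis .
qed

text \<open>
  Of the header \<open>1\<^sup>b 0 u v\<close> with \<open>b = length u\<close>, the numbers \<open>n\<close> and \<open>l\<close> are read off as the ranks of \<open>u\<close>
  and \<open>v\<close>; the string \<open>s\<close> is the index of \<open>z\<close>. The saving \<open>4 b\<close> exceeds the header length \<open>3 b + 1\<close>.
\<close>

lemma ex_prefix_machine:
  assumes "computable1 U"
  obtains D where "computable1 D"
    and "\<And>u v z w x. length u = length v \<Longrightarrow> 4 * length u \<le> str_rank v + 1 \<Longrightarrow> str_rank v \<le> str_rank u \<Longrightarrow>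
      length z = str_rank v \<Longrightarrow> U (z @ w) = Some x \<Longrightarrow>
      2 ^ (str_rank u - str_rank v - 1) \<le>
        card {r. length r = str_rank u - str_rank v \<and> z @ r \<in> describable U (str_rank u - 4 * length u)} \<Longrightarrow>
      \<exists>s. length s + 4 * length u = str_rank v + 1 \<and>
        D (replicate (length u) True @ False # u @ v @ s @ w) = Some x"
proof -
  \<comment> \<open>The environment holds the complexity threshold, the length of the extensions and
    the length of the prefix, in this order.\<close>
  define P where "P z e \<longleftrightarrow> str_code (str_decode z) = z \<and> length (str_decode z) = e (Suc (Suc 0)) \<and>
    2 ^ (e (Suc 0) - 1) \<le> card {r. str_code (str_decode r) = r \<and> length (str_decode r) = e (Suc 0) \<and>
      (\<exists>q. length (str_decode q) < e 0 \<and> U (str_decode q) = Some (str_decode z @ str_decode r))}" for z and e :: "nat \<Rightarrow> nat"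
  have "semidecidable (Suc (Suc (Suc (Suc 0)))) (\<lambda>e. P (e 0) (\<lambda>n. e (Suc n)))"
    unfolding P_def
  proof (intro semidecidable_conj semidecidable_card semidecidable_ex semidecidable_machine[OF assms] semidecidable_decidable comp_intros)
    show "finite {r. str_code (str_decode r) = r \<and> length (str_decode r) = e (Suc (Suc 0)) \<and>
      (\<exists>q. length (str_decode q) < e (Suc 0) \<and> U (str_decode q) = Some (str_decode (e 0) @ str_decode r))}" for e
    proof (rule finite_subset)
      show "finite (str_code ` {r. length r = e (Suc (Suc 0))})" using finite_strings by blast
    qed (auto simp: image_iff, metis)
  qed simp_all
  then obtain E where E: "semidecidable (Suc (Suc (Suc (Suc (Suc 0))))) (\<lambda>e. E (e 0) (e (Suc 0)) (\<lambda>n. e (Suc (Suc n))))"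
    and E_P: "\<And>i z e. E i z e \<Longrightarrow> P z e"
    and E_unique: "\<And>i y z e. E i y e \<Longrightarrow> E i z e \<Longrightarrow> y = z"
    and E_ex: "\<And>z e. finite {z. P z e} \<Longrightarrow> P z e \<Longrightarrow> \<exists>i<card {z. P z e}. E i z e"
    by (rule semidecidable_enumeration) (rule that)
  have semidecidable_E: "semidecidable k (\<lambda>e. E (I e) (V e) (case_nat (M e) (case_nat (N e) (\<lambda>_. L e))))"
    if "recursive k I" "recursive k V" "recursive k M" "recursive k N" "recursive k L" for k I V M N L
  proof -
    let ?G = "\<lambda>e. case_nat (I e) (case_nat (V e) (case_nat (M e) (case_nat (N e) (\<lambda>_. L e))))"
    have "recursive k (\<lambda>e. ?G e i)" for i
      using that by (cases i; cases "i - 1"; cases "i - 2"; cases "i - 3") simp_all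
    from semidecidable_comp[OF E, of k ?G, OF this] show ?thesis by simp
  qed
  \<comment> \<open>The equation for the length of \<open>s\<close> marks where \<open>s\<close>
    ends and \<open>w\<close> begins; the index needs no delimiter of its own.\<close>
  define R where "R q x \<longleftrightarrow> (\<exists>b u v s w z.
    q = replicate b True @ [False] @ str_decode u @ str_decode v @ str_decode s @ str_decode w \<and>
    length (str_decode u) = b \<and> length (str_decode v) = b \<and> length (str_decode s) + 4 * b = str_rank (str_decode v) + 1 \<and>
    E (str_rank (str_decode s)) z (case_nat (str_rank (str_decode u) - 4 * b)
      (case_nat (str_rank (str_decode u) - str_rank (str_decode v)) (\<lambda>_. str_rank (str_decode v)))) \<and>
    U (str_decode z @ str_decode w) = Some x)" for q x
  obtain D where D: "computable1 D" "\<And>q x. R q x \<Longrightarrow> D q = Some x"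
  proof (rule ex_computable1)
    show "semidecidable (Suc (Suc 0)) (\<lambda>e. R (str_decode (e (Suc 0))) (str_decode (e 0)))"
      unfolding R_def by (intro semidecidable_ex semidecidable_conj semidecidable_E semidecidable_machine[OF assms] semidecidable_decidable comp_intros; simp)
    show "x = x'" if x: "R q x" and x': "R q x'" for q x x'
    proof -
      from x obtain b u v s w z where 1:
        "q = replicate b True @ False # str_decode u @ str_decode v @ str_decode s @ str_decode w"
        "length (str_decode u) = b" "length (str_decode v) = b" "length (str_decode s) + 4 * b = str_rank (str_decode v) + 1"
        "E (str_rank (str_decode s)) z (case_nat (str_rank (str_decode u) - 4 * b)
          (case_nat (str_rank (str_decode u) - str_rank (str_decode v)) (\<lambda>_. str_rank (str_decode v))))"
        "U (str_decode z @ str_decode w) = Some x"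
        unfolding R_def by auto
      from x' obtain b' u' v' s' w' z' where 2:
        "q = replicate b' True @ False # str_decode u' @ str_decode v' @ str_decode s' @ str_decode w'"
        "length (str_decode u') = b'" "length (str_decode v') = b'" "length (str_decode s') + 4 * b' = str_rank (str_decode v') + 1"
        "E (str_rank (str_decode s')) z' (case_nat (str_rank (str_decode u') - 4 * b')
          (case_nat (str_rank (str_decode u') - str_rank (str_decode v')) (\<lambda>_. str_rank (str_decode v'))))"
        "U (str_decode z' @ str_decode w') = Some x'"
        unfolding R_def by auto
      from 1(1) 2(1) have eq: "b = b'" "str_decode u @ str_decode v @ str_decode s @ str_decode w = str_decode u' @ str_decode v' @ str_decode s' @ str_decode w'"
        by (metis replicate_True_inject)+
      with 1(2,3) 2(2,3) have uv: "str_decode u = str_decode u'" "str_decode v = str_decode v'" "str_decode s @ str_decode w = str_decode s' @ str_decode w'"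
        by auto
      moreover from this 1(4) 2(4) eq(1) have "length (str_decode s) = length (str_decode s')" by simp
      ultimately have sw: "str_decode s = str_decode s'" "str_decode w = str_decode w'" by auto
      from 1(5) 2(5) have "z = z'" unfolding uv sw eq(1) by (rule E_unique)
      with 1(6) 2(6) sw show ?thesis by simp
    qed
  qed (rule that)
  show thesis
  proof
    show "computable1 D" by fact
    fix u v z w x
    assume len: "length u = length v" and b: "4 * length u \<le> str_rank v + 1" and le: "str_rank v \<le> str_rank u"
      and z: "length z = str_rank v" and U: "U (z @ w) = Some x"
      and rich: "2 ^ (str_rank u - str_rank v - 1) \<le>
        card {r. length r = str_rank u - str_rank v \<and> z @ r \<in> describable U (str_rank u - 4 * length u)}"
    let ?m = "str_rank u - 4 * length u" and ?d = "str_rank u - str_rank v"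
    let ?e = "case_nat ?m (case_nat ?d (\<lambda>_. str_rank v))"
    let ?Z = "{z. length z = str_rank v \<and> 2 ^ (?d - 1) \<le> card {r. length r = ?d \<and> z @ r \<in> describable U ?m}}"
    have desc: "(\<exists>q. length (str_decode q) < m \<and> U (str_decode q) = Some y) \<longleftrightarrow> y \<in> describable U m" for m y
      unfolding describable_def using ex_str_decode[of "\<lambda>q. length q < m \<and> U q = Some y"] by simp
    have P: "P c ?e \<longleftrightarrow> str_code (str_decode c) = c \<and> str_decode c \<in> ?Z" for c
      unfolding P_def by (simp add: desc card_codes[of "\<lambda>r. length r = ?d \<and> str_decode c @ r \<in> describable U ?m"])
    have finZ: "finite ?Z" by (rule finite_subset[OF _ finite_strings[of "str_rank v"]]) auto
    have PZ: "{c. P c ?e} = str_code ` ?Z"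
      unfolding P using codes_eq_image[of "\<lambda>z. z \<in> ?Z"] by simp
    have card: "card {c. P c ?e} = card ?Z"
      unfolding PZ by (rule card_image) (simp add: inj_on_def)
    have "P (str_code z) ?e" unfolding P using z rich by simp
    from E_ex[OF _ this] obtain i where i: "i < card ?Z" "E i (str_code z) ?e"
      unfolding card using finZ PZ by auto
    have "card ?Z \<le> 2 ^ (str_rank v + 1 - 4 * length u)"
    proof -
      note card_rich_prefixes[of "str_rank v" ?d U ?m]
      \<comment> \<open>Writing n and l for the ranks of \<open>u\<close> and \<open>v\<close>, the
        exponents are n - 4b and n - l - 1, which differ by l + 1 - 4b; the case n = l, where
        subtraction truncates, only needs the inequality. The difference becomes the length of
        \<open>s\<close>.\<close>
      also have "(2::nat) ^ ?m \<le> 2 ^ (str_rank v + 1 - 4 * length u) * 2 ^ (?d - 1)"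
        unfolding power_add[symmetric] by (rule power_increasing) (use b le in simp_all)
      finally show ?thesis by simp
    qed
    with i(1) have "i < 2 ^ (str_rank v + 1 - 4 * length u)" by linarith
    from ex_str_rank[OF this] obtain s where s: "length s = str_rank v + 1 - 4 * length u" "str_rank s = i" by blast
    have i': "E (str_rank s) (str_code z) ?e" using i(2) by (simp only: s(2))
    have len_s: "length s + 4 * length u = str_rank v + 1" using s(1) b by simp
    have "R (replicate (length u) True @ False # u @ v @ s @ w) x"
      unfolding R_def
      by (intro exI[of _ "length u"] exI[of _ "str_code u"] exI[of _ "str_code v"] exI[of _ "str_code s"]
          exI[of _ "str_code w"] exI[of _ "str_code z"] conjI)
        (simp_all only: str_decode_str_code append_Cons append_Nil len len_s[unfolded len] i'[unfolded len] U)
    with D(2) len_s show "\<exists>s. length s + 4 * length u = str_rank v + 1 \<and>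
        D (replicate (length u) True @ False # u @ v @ s @ w) = Some x"
      by blast
  qed
qed

subsection \<open>The counting argument\<close>

lemma KC_le: "U p = Some x \<Longrightarrow> KC U x \<le> length p"
  unfolding KC_def by (rule Least_le) blast

lemma KCc_le: "V p y = Some x \<Longrightarrow> KCc V x y \<le> length p"
  unfolding KCc_def by (rule Least_le) blast

lemma KC_attained:
  assumes "U q = Some x" obtains p where "U p = Some x" "length p = KC U x"
proof -
  from assms have "\<exists>k p. length p = k \<and> U p = Some x" by blast
  from LeastI_ex[OF this] that show thesis unfolding KC_def by blast
qed

text \<open>Universality is applied to the identity machine. Besides the bound on \<open>KC\<close>
  this shows that every string has a program, without which \<open>LEAST\<close> would say
  nothing.\<close>

lemma universal1_program:
  assumes "universal1 U"
  shows "\<exists>c. \<forall>x. \<exists>q. U q = Some x \<and> length q \<le> length x + c"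
proof -
  obtain M where M: "computable1 M" "\<And>p x. p = x \<Longrightarrow> M p = Some x"
  proof (rule ex_computable1)
    show "semidecidable (Suc (Suc 0)) (\<lambda>e. str_decode (e (Suc 0)) = str_decode (e 0))"
      by (intro semidecidable_decidable comp_intros; simp)
  qed (auto intro: that)
  from assms M(1) obtain c
    where "\<And>p x. M p = Some x \<Longrightarrow> \<exists>q. U q = Some x \<and> length q \<le> length p + c"
    unfolding universal1_def by blast
  from this[OF M(2)[OF refl]] show ?thesis by blast
qed

text \<open>Integer form of the theorem, with \<open>b\<close> in the role of log n and
  \<open>l\<close> as prefix length; logarithms and rounding are left to the end. The set contains
  at least half of the extensions of one prefix of a shortest program of \<open>x\<close>.\<close>

lemma many_incompressible_relatives:
  assumes U: "universal1 U" and V: "universal2 V"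
  obtains c where "\<And>x. KC U x \<le> length x + c"
    and "\<And>x l b. length x < 2 ^ b \<Longrightarrow> l \<le> length x \<Longrightarrow> l \<le> KC U x \<Longrightarrow> 4 * b \<le> l + 1 \<Longrightarrow>
      c + 2 < b \<Longrightarrow> c \<le> length x \<Longrightarrow>
      2 ^ (length x - l) \<le> 2 * card {y. length y = length x \<and> length x - 4 * b \<le> KC U y \<and>
        KCc V y x \<le> length x - l + 2 * b + 3 + c}"
proof -
  from U have cU: "computable1 U" by (simp add: universal1_def)
  obtain W where "computable2 W"
    and W: "\<And>q x. U q = Some x \<Longrightarrow> \<exists>p. length p = length q \<and> U p = Some x \<and>
      (\<forall>u z w r. str_rank u = length p \<longrightarrow> p = z @ w \<longrightarrow> length z + length r = length x \<longrightarrow>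
        W (replicate (length u) True @ False # u @ r) x = Some (z @ r))"
    using ex_cond_machine[OF cU] by blast
  with V obtain c1 where c1: "\<And>p y x. W p y = Some x \<Longrightarrow> \<exists>q. V q y = Some x \<and> length q \<le> length p + c1"
    unfolding universal2_def by blast
  obtain D where "computable1 D"
    and D: "\<And>u v z w x. length u = length v \<Longrightarrow> 4 * length u \<le> str_rank v + 1 \<Longrightarrow> str_rank v \<le> str_rank u \<Longrightarrow>
      length z = str_rank v \<Longrightarrow> U (z @ w) = Some x \<Longrightarrow>
      2 ^ (str_rank u - str_rank v - 1) \<le>
        card {r. length r = str_rank u - str_rank v \<and> z @ r \<in> describable U (str_rank u - 4 * length u)} \<Longrightarrow>
      \<exists>s. length s + 4 * length u = str_rank v + 1 \<and>
        D (replicate (length u) True @ False # u @ v @ s @ w) = Some x"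
    using ex_prefix_machine[OF cU] by blast
  with U obtain c2 where c2: "\<And>p x. D p = Some x \<Longrightarrow> \<exists>q. U q = Some x \<and> length q \<le> length p + c2"
    unfolding universal1_def by blast
  obtain c0 where c0: "\<And>x. \<exists>q. U q = Some x \<and> length q \<le> length x + c0"
    using universal1_program[OF U] by blast
  define c where "c = c0 + c1 + c2"
  have KC_c0: "KC U x \<le> length x + c0" for x
    using c0[of x] KC_le by (metis order_trans)
  show thesis
  proof
    show "KC U x \<le> length x + c" for x using KC_c0[of x] by (simp add: c_def)
    fix x :: "bool list" and l b :: nat
    let ?n = "length x"
    let ?d = "?n - l"
    let ?m = "?n - 4 * b"
    assume n: "?n < 2 ^ b" and ln: "l \<le> ?n" and lk: "l \<le> KC U x" and b: "4 * b \<le> l + 1"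
      and c: "c + 2 < b" and cn: "c \<le> ?n"
    obtain q where q: "U q = Some x" "length q = KC U x"
      using c0[of x] KC_attained by metis
    \<comment> \<open>The shortest program \<open>q\<close> is exchanged for the one that
      \<open>W\<close> finds; it has the same length, so it is shortest too.\<close>
    from W[OF q(1)] obtain p where p: "length p = KC U x" "U p = Some x"
      and Wp: "\<And>u z w r. str_rank u = length p \<Longrightarrow> p = z @ w \<Longrightarrow> length z + length r = ?n \<Longrightarrow>
        W (replicate (length u) True @ False # u @ r) x = Some (z @ r)"
      unfolding q(2) by blast
    define z w where "z = take l p" and "w = drop l p"
    have zw: "p = z @ w" "length z = l" "length w = KC U x - l"
      using lk p(1) by (simp_all add: z_def w_def)
    obtain u where u: "length u = b" "str_rank u = ?n" using ex_str_rank[OF n] by blast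
    obtain v where v: "length v = b" "str_rank v = l" using ex_str_rank[of l b] n ln by auto
    let ?low = "{r. length r = ?d \<and> z @ r \<in> describable U ?m}"
    let ?high = "{r. length r = ?d \<and> z @ r \<notin> describable U ?m}"
    have low: "card ?low < 2 ^ (?d - 1)"
    proof (rule ccontr)
      assume "\<not> card ?low < 2 ^ (?d - 1)"
      then have "\<exists>s. length s + 4 * b = l + 1 \<and> D (replicate b True @ False # u @ v @ s @ w) = Some x"
        using D[of u v z w x] u v b ln zw p(2) by simp
      then obtain s where s: "length s + 4 * b = l + 1" "D (replicate b True @ False # u @ v @ s @ w) = Some x"
        by blast
      from c2[OF s(2)] obtain q where "U q = Some x"
        "length q \<le> length (replicate b True @ False # u @ v @ s @ w) + c2" by blast
      then have "KC U x \<le> length (replicate b True @ False # u @ v @ s @ w) + c2"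
        using KC_le[of U q x] by linarith
      \<comment> \<open>The header takes \<open>3 * b + 1\<close> bits, \<open>s\<close> takes
        \<open>l + 1 - 4 * b\<close> and \<open>w\<close> takes \<open>KC U x - l\<close>, in total
        \<open>KC U x - b + 2\<close>. By \<open>c + 2 < b\<close> this stays below
        \<open>KC U x\<close> even with \<open>c2\<close> added.\<close>
      then show False using s(1) u(1) v(1) zw(3) lk c by (simp add: c_def)
    qed
    have fin: "finite ?low" "finite ?high"
      by (rule finite_subset[OF _ finite_strings[of ?d]]; blast)+
    have "card ?low + card ?high = card (?low \<union> ?high)"
      by (rule card_Un_disjoint[symmetric]) (use fin in auto)
    also have "?low \<union> ?high = {r. length r = ?d}" by blast
    finally have sum: "card ?low + card ?high = 2 ^ ?d" by (simp add: card_strings)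
    have "2 ^ d \<le> 2 * h" if "a < 2 ^ (d - 1)" "a + h = 2 ^ d" for a h d :: nat
      using that by (cases d) simp_all
    from this[OF low sum] have "2 ^ ?d \<le> 2 * card ?high" .
    moreover have "card ?high \<le> card {y. length y = ?n \<and> ?m \<le> KC U y \<and> KCc V y x \<le> ?d + 2 * b + 3 + c}"
      (is "_ \<le> card ?Y")
    proof (rule card_inj_on_le[where f = "\<lambda>r. z @ r"])
      show "(\<lambda>r. z @ r) ` ?high \<subseteq> ?Y"
      proof (rule image_subsetI)
        fix r assume "r \<in> ?high"
        then have r: "length r = ?d" "z @ r \<notin> describable U ?m" by auto
        have len: "length z + length r = ?n" using zw r ln by simp
        obtain q' where "U q' = Some (z @ r)" "length q' = KC U (z @ r)"
          using c0[of "z @ r"] KC_attained by metis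
        with r(2) have "?m \<le> KC U (z @ r)" unfolding describable_def by force
        moreover have "KCc V (z @ r) x \<le> ?d + 2 * b + 3 + c"
        proof -
          \<comment> \<open>The length of \<open>p\<close> may exceed that of \<open>x\<close>, but
            by at most \<open>c \<le> length x\<close>, so \<open>b + 1\<close> bits suffice. The
            header then has \<open>2 * b + 3\<close> bits.\<close>
          have "KC U x < 2 ^ Suc b" using KC_c0[of x] n cn by (simp add: c_def)
          from ex_str_rank[OF this] obtain t where t: "length t = Suc b" "str_rank t = length p"
            using p(1) by metis
          from c1[OF Wp[OF t(2) zw(1) len]] obtain q'' where "V q'' x = Some (z @ r)"
            "length q'' \<le> length (replicate (length t) True @ False # t @ r) + c1" by blast
          then have "KCc V (z @ r) x \<le> length (replicate (length t) True @ False # t @ r) + c1"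
            using KCc_le[of V q'' x "z @ r"] by linarith
          then show ?thesis using t(1) r(1) by (simp add: c_def)
        qed
        ultimately show "z @ r \<in> ?Y" using len by simp
      qed
      show "finite ?Y" by (rule finite_subset[OF _ finite_strings[of ?n]]) blast
    qed (simp add: inj_on_def)
    ultimately show "2 ^ ?d \<le> 2 * card ?Y" by linarith
  qed
qed

theorem theorem1:
  fixes U :: "bool list \<Rightarrow> bool list option"
    and V :: "bool list \<Rightarrow> bool list \<Rightarrow> bool list option"
  assumes "universal1 U" and "universal2 V"
  shows "\<exists>N. \<forall>n\<ge>N. \<forall>\<alpha>::nat. \<forall>x. length x = n \<longrightarrow>
           real (KC U x) \<ge> real \<alpha> + 7 * log 2 (real n) \<longrightarrow>
           real (card (A_set U V n x \<alpha>)) \<ge> 2 powr (real n - real \<alpha>) / (2 * real n ^ 7)"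
proof -
  obtain c where c: "\<And>x. KC U x \<le> length x + c"
    and many: "\<And>x l b. length x < 2 ^ b \<Longrightarrow> l \<le> length x \<Longrightarrow> l \<le> KC U x \<Longrightarrow> 4 * b \<le> l + 1 \<Longrightarrow>
      c + 2 < b \<Longrightarrow> c \<le> length x \<Longrightarrow>
      2 ^ (length x - l) \<le> 2 * card {y. length y = length x \<and> length x - 4 * b \<le> KC U y \<and>
        KCc V y x \<le> length x - l + 2 * b + 3 + c}"
    using many_incompressible_relatives[OF assms] by blast
  show ?thesis
  \<comment> \<open>The requirement is \<open>\<alpha> + 6 * b + 3 + c \<le> l\<close>; with
    \<open>b \<le> lg + 1\<close> and \<open>l \<ge> \<alpha> + 7 * lg - 1 - c\<close> it follows
    from \<open>lg \<ge> 2 * c + 10\<close>.\<close>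
  proof (rule exI[of _ "2 ^ (2 * c + 10)"], intro allI impI)
    fix n \<alpha> :: nat and x :: "bool list"
    assume N: "2 ^ (2 * c + 10) \<le> n" and x: "length x = n"
      and KCx: "real \<alpha> + 7 * log 2 (real n) \<le> real (KC U x)"
    define lg where "lg = log 2 (real n)"
    have n0: "0 < n" using N by (metis gr0I not_le zero_less_numeral zero_less_power)
    have lg_ge: "real (2 * c + 10) \<le> lg" unfolding lg_def using N n0 le_log2_of_power by blast
    obtain b' where b': "2 ^ b' \<le> n" "n < 2 ^ Suc b'"
      using ex_power_ivl1[of 2 n] n0 by auto
    define b where "b = Suc b'"
    have b_le: "real b \<le> lg + 1"
      unfolding b_def lg_def using le_log2_of_power[OF b'(1)] n0 by simp
    have "(2::nat) ^ (2 * c + 10) < 2 ^ b" using N b'(2) unfolding b_def by (rule le_less_trans)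
    then have b_gt: "2 * c + 10 < b" by simp
    have "2 * c + 10 < 2 ^ (2 * c + 10)" by (rule less_exp)
    with N have cn: "c \<le> n" by linarith
    have KC_le_n: "real (KC U x) \<le> real n + real c" using c[of x] x by simp
    \<comment> \<open>\<open>KC U x\<close> may exceed \<open>n\<close> by up to \<open>c\<close>,
      and so may \<open>\<alpha> + 7 * lg\<close>; a prefix longer than \<open>n\<close> would leave
      no room in \<open>y\<close>. The cut loses at most \<open>c\<close>, the floor at most
      1.\<close>
    define l where "l = min (nat \<lfloor>real \<alpha> + 7 * lg\<rfloor>) n"
    have lg0: "0 \<le> real \<alpha> + 7 * lg" using lg_ge by simp
    have l_le: "real l \<le> real \<alpha> + 7 * lg" using lg0 unfolding l_def by linarith
    have l_gt: "real \<alpha> + 7 * lg - 1 - real c \<le> real l"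
      using KC_le_n KCx unfolding l_def lg_def[symmetric] by linarith
    have bl: "4 * b \<le> l + 1"
    proof -
      have "real (4 * b) \<le> real (l + 1)" using b_le l_gt lg_ge by simp
      then show ?thesis by linarith
    qed
    let ?Y = "{y. length y = n \<and> n - 4 * b \<le> KC U y \<and> KCc V y x \<le> n - l + 2 * b + 3 + c}"
    have "2 ^ (n - l) \<le> 2 * card ?Y"
    proof (rule many[of x b l, unfolded x])
      show "n < 2 ^ b" using b' by (simp add: b_def)
      show "l \<le> KC U x" using l_le KCx unfolding lg_def by linarith
      show "c + 2 < b" using b_gt by simp
    qed (use bl cn in \<open>simp_all add: l_def\<close>)
    also have "card ?Y \<le> card (A_set U V n x \<alpha>)"
    proof (rule card_mono)
      show "finite (A_set U V n x \<alpha>)"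
        unfolding A_set_def by (rule finite_subset[OF _ finite_strings[of n]]) blast
      \<comment> \<open>For members of \<open>?Y\<close> the difference of complexities is at least
        \<open>l - 6 * b - 3 - c\<close>: the lowered threshold contributes \<open>4 * b\<close>,
        the header in the conditional program \<open>2 * b + 3\<close>.\<close>
      have "real \<alpha> + 6 * real b + 3 + real c \<le> real l" using b_le l_gt lg_ge by simp
      then have "\<alpha> + 6 * b + 3 + c \<le> l" by linarith
      moreover have "l \<le> n" by (simp add: l_def)
      ultimately show "?Y \<subseteq> A_set U V n x \<alpha>" unfolding A_set_def by auto
    qed
    finally have "real (2 ^ (n - l)) \<le> real (2 * card (A_set U V n x \<alpha>))"
      by (simp only: of_nat_le_iff)
    then have card: "2 powr real (n - l) \<le> 2 * real (card (A_set U V n x \<alpha>))"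
      by (simp add: powr_realpow)
    have "real n ^ 7 = (2 powr lg) ^ 7" using n0 by (simp add: lg_def)
    also have "\<dots> = 2 powr (7 * lg)" by (simp add: powr_power)
    finally have n7: "real n ^ 7 = 2 powr (7 * lg)" .
    have "2 powr (real n - real \<alpha>) / real n ^ 7 = 2 powr (real n - real \<alpha> - 7 * lg)"
      unfolding n7 by (simp add: powr_diff)
    also have "\<dots> \<le> 2 powr real (n - l)" using l_le by (intro powr_mono) auto
    also note card
    finally show "2 powr (real n - real \<alpha>) / (2 * real n ^ 7) \<le> real (card (A_set U V n x \<alpha>))"
      by (simp add: field_simps)
  qed
qed

end
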